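(* Let $f:\mathbb{R}^n\to\mathbb{R}$ be differentiable and strongly convex with parameter $m_f>0$, let its gradient be Lipschitz continuous with parameter $L_f$, let $g:\mathbb{R}^m\to\mathbb{R}\cup\{+\infty\}$ be proper, lower semicontinuous, and convex, let $T\in\mathbb{R}^{m\times n}$ be such that $TT^T$ is full rank, and let $\mu>0$. If $\mu\ge L_f-m_f$, then there is a $\rho>0$ such that the gradient flow dynamics $$\dot x=-\nabla_x\mathcal{L}_\mu(x;y)=-\big(\nabla f(x)+T^T\nabla M_{\mu g}(Tx+\mu y)\big),$$ $$\dot y=\nabla_y\mathcal{L}_\mu(x;y)=\mu\big(\nabla M_{\mu g}(Tx+\mu y)-y\big)$$ converge $\rho$-exponentially to the optimal (primal-dual) point $w^\star=(x^\star,y^\star)$ of the problem $$\min_{x,z}\ f(x)+g(z)\quad\text{subject to}\quad Tx-z=0 .$$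
   Context: Standing assumptions: the problem $\min_x f(x)+g(Tx)$ is feasible and its minimum is finite. The proximal operator of $g$ is $\mathbf{prox}_{\mu g}(v)=\operatorname*{argmin}_{u}\big(g(u)+\tfrac{1}{2\mu}\|u-v\|^2\big)$ and the Moreau envelope is $M_{\mu g}(v)=g(\mathbf{prox}_{\mu g}(v))+\tfrac{1}{2\mu}\|\mathbf{prox}_{\mu g}(v)-v\|^2$; it is continuously differentiable with $\nabla M_{\mu g}(v)=\tfrac1\mu(v-\mathbf{prox}_{\mu g}(v))$. The proximal augmented Lagrangian is $\mathcal{L}_\mu(x;y)=f(x)+M_{\mu g}(Tx+\mu y)-\tfrac{\mu}{2}\|y\|^2$. An optimal primal-dual point is a pair $w^\star=(x^\star,y^\star)\in\mathbb{R}^n\times\mathbb{R}^m$ that, with some $z^\star\in\mathbb{R}^m$, satisfies $0=\nabla f(x^\star)+T^Ty^\star$, $\ y^\star\in\partial g(z^\star)$, $\ Tx^\star=z^\star$, where $\partial g$ is the subdifferential of $g$. The dynamics, with state $w=(x,y)$, converge $\rho$-exponentially to $w^\star$ if there is a constant $\tau>0$ such that $\|w(t)-w^\star\|\le\tau e^{-\rho t}\|w(0)-w^\star\|$ for all $t\ge0$ and all initial conditions $w(0)\in\mathbb{R}^n\times\mathbb{R}^m$. The function $f$ is $m_f$-strongly convex if $f(x)-\tfrac{m_f}{2}\|x\|^2$ is convex. *)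

theory Defs
  imports "HOL-Analysis.Analysis"
begin

definition gradient :: "('a::real_inner \<Rightarrow> real) \<Rightarrow> 'a \<Rightarrow> 'a" where
  "gradient f x = (THE D. GDERIV f x :> D)"

definition strongly_convex :: "real \<Rightarrow> ('a::real_inner \<Rightarrow> real) \<Rightarrow> bool" where
  "strongly_convex m f \<longleftrightarrow> convex_on UNIV (\<lambda>x. f x - m / 2 * (norm x)\<^sup>2)"

definition proper_fun :: "('a \<Rightarrow> ereal) \<Rightarrow> bool" where
  "proper_fun g \<longleftrightarrow> (\<forall>x. g x \<noteq> -\<infinity>) \<and> (\<exists>x. g x \<noteq> \<infinity>)"

definition lsc_fun :: "('a::topological_space \<Rightarrow> ereal) \<Rightarrow> bool" where
  "lsc_fun g \<longleftrightarrow> (\<forall>x. g x \<le> Liminf (at x) g)"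

text \<open>Convexity of an extended-valued function. It is only meant for functions that do not take
  the value \<open>-\<infinity>\<close>; recall that \<open>0 * \<infinity> = 0\<close> in \<^typ>\<open>ereal\<close>.\<close>

definition convex_fun :: "('a::real_vector \<Rightarrow> ereal) \<Rightarrow> bool" where
  "convex_fun g \<longleftrightarrow>
     (\<forall>x y. \<forall>u\<in>{0..1::real}.
        g ((1 - u) *\<^sub>R x + u *\<^sub>R y) \<le> ereal (1 - u) * g x + ereal u * g y)"

text \<open>For proper \<open>g\<close> this set is empty at points where \<open>g\<close> is infinite.\<close>

definition subdifferential :: "('a::real_inner \<Rightarrow> ereal) \<Rightarrow> 'a \<Rightarrow> 'a set" where
  "subdifferential g z = {y. \<forall>u. g u \<ge> g z + ereal (inner y (u - z))}"

text \<open>The minimiser exists and is unique for proper, lower semicontinuous, convex \<open>g\<close> and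
  \<open>\<mu> > 0\<close>; otherwise the value is unspecified.\<close>

definition prox :: "real \<Rightarrow> ('a::real_inner \<Rightarrow> ereal) \<Rightarrow> 'a \<Rightarrow> 'a" where
  "prox \<mu> g v = (ARG_MIN (\<lambda>u. g u + ereal (1 / (2 * \<mu>) * (norm (u - v))\<^sup>2)) u. True)"

definition moreau :: "real \<Rightarrow> ('a::real_inner \<Rightarrow> ereal) \<Rightarrow> 'a \<Rightarrow> real" where
  "moreau \<mu> g v =
     real_of_ereal (g (prox \<mu> g v) + ereal (1 / (2 * \<mu>) * (norm (prox \<mu> g v - v))\<^sup>2))"

definition prox_aug_lagrangian ::
  "real \<Rightarrow> (real^'n \<Rightarrow> real) \<Rightarrow> (real^'m \<Rightarrow> ereal) \<Rightarrow> real^'n^'m \<Rightarrow> real^'n \<Rightarrow> real^'m \<Rightarrow> real" where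
  "prox_aug_lagrangian \<mu> f g T x y =
     f x + moreau \<mu> g (T *v x + \<mu> *\<^sub>R y) - \<mu> / 2 * (norm y)\<^sup>2"

definition optimal_primal_dual ::
  "(real^'n \<Rightarrow> real) \<Rightarrow> (real^'m \<Rightarrow> ereal) \<Rightarrow> real^'n^'m \<Rightarrow> (real^'n) \<times> (real^'m) \<Rightarrow> bool" where
  "optimal_primal_dual f g T w \<longleftrightarrow>
     (\<exists>z. 0 = gradient f (fst w) + transpose T *v snd w \<and>
          snd w \<in> subdifferential g z \<and> T *v fst w = z)"

definition gradient_flow_field ::
  "real \<Rightarrow> (real^'n \<Rightarrow> real) \<Rightarrow> (real^'m \<Rightarrow> ereal) \<Rightarrow> real^'n^'m \<Rightarrow>
     (real^'n) \<times> (real^'m) \<Rightarrow> (real^'n) \<times> (real^'m)" where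
  "gradient_flow_field \<mu> f g T w =
     (- gradient (\<lambda>x. prox_aug_lagrangian \<mu> f g T x (snd w)) (fst w),
      gradient (\<lambda>y. prox_aug_lagrangian \<mu> f g T (fst w) y) (snd w))"

definition solves_ode ::
  "('a::real_normed_vector \<Rightarrow> 'a) \<Rightarrow> 'a \<Rightarrow> (real \<Rightarrow> 'a) \<Rightarrow> bool" where
  "solves_ode F w0 w \<longleftrightarrow>
     w 0 = w0 \<and> (\<forall>t\<ge>0. (w has_vector_derivative F (w t)) (at t within {0..}))"

text \<open>The first conjunct makes the dynamics well posed, so that the bound on trajectories is not
  vacuous for any initial condition.\<close>

definition converges_exponentially ::
  "real \<Rightarrow> ('a::real_normed_vector \<Rightarrow> 'a) \<Rightarrow> 'a \<Rightarrow> bool" where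
  "converges_exponentially \<rho> F ws \<longleftrightarrow>
     (\<exists>\<tau>>0. \<forall>w0. (\<exists>w. solves_ode F w0 w) \<and>
        (\<forall>w. solves_ode F w0 w \<longrightarrow>
           (\<forall>t\<ge>0. norm (w t - ws) \<le> \<tau> * exp (- \<rho> * t) * norm (w 0 - ws))))"

end

theory Submission
  imports Defs
begin

text \<open>Convergence follows from a quadratic Lyapunov function
  \<open>(norm x)\<^sup>2 + (norm y)\<^sup>2 + 2 * \<epsilon> * inner (T x) y\<close> with small \<open>\<epsilon>\<close>. Strong convexity of \<open>f\<close> and
  firm nonexpansiveness of \<open>v - prox \<mu> g v\<close> make the vector field strongly monotone in the
  corresponding inner product; the cross term controls \<open>y\<close> because \<open>transpose T\<close> is injective.
  Since the field is also Lipschitz, it has exactly one zero, which is the optimal primal-dual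
  point, and its trajectories exist for all time.\<close>

subsection \<open>Ordinary differential equations with Lipschitz right-hand side\<close>

text \<open>What the dynamics need to know about \<open>g\<close> is a single inequality for the
  gradient \<open>G\<close> of its Moreau envelope, cocoercivity:
  \<open>\<mu> * (norm (G v - G v'))\<^sup>2\<close> is at most
  \<open>inner (G v - G v') (v - v')\<close>. It follows from monotonicity of the subdifferential,
  so nonsmooth and infinite values do no harm. The obstacle is damping in \<open>y\<close>. Where
  \<open>prox\<close> is locally constant, displacing \<open>y\<close> alone moves \<open>G\<close>
  by exactly the same displacement, and the \<open>y\<close> equation does not react. Such a
  displacement acts only on \<open>x\<close>, through \<open>transpose T\<close>, and the cross term
  is what registers this. The optimal pair is not obtained from duality: it is the zero of the
  field, and it is recognised as optimal because \<open>prox\<close> is the resolvent of the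
  subdifferential.\<close>

lemma integral_has_vector_derivative_atLeast:
  fixes G :: "real \<Rightarrow> 'a::banach"
  assumes "continuous_on {a..} G" "a \<le> t"
  shows "((\<lambda>u. integral {a..u} G) has_vector_derivative G t) (at t within {a..})"
proof -
  have "((\<lambda>u. integral {a..u} G) has_vector_derivative G t) (at t within {a..t+1})"
    by (rule integral_has_vector_derivative) (use assms in \<open>auto intro: continuous_on_subset\<close>)
  moreover have "at t within {a..t+1} = at t within {a..}"
    by (rule at_within_nhd[of _ "{..<t+1}"]) auto
  ultimately show ?thesis by simp
qed

lemma integral_scaled_exp:
  fixes K t b :: real
  assumes "K \<noteq> 0" "0 \<le> t"
  shows "((\<lambda>s. b * exp (K * s)) has_integral (b / K * (exp (K * t) - 1))) {0..t}"
proof -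
  have "((\<lambda>s. b * exp (K * s)) has_integral (b / K * exp (K * t) - b / K * exp (K * 0))) {0..t}"
    by (rule fundamental_theorem_of_calculus[OF assms(2)])
      (use assms(1) in \<open>auto intro!: derivative_eq_intros
        simp: has_real_derivative_iff_has_vector_derivative[symmetric]\<close>)
  then show ?thesis by (simp add: algebra_simps)
qed

text \<open>Picard iteration, carried out for \<open>u t = exp (- K * t) *\<^sub>R (w t - w0)\<close> with \<open>K\<close> above the
  Lipschitz constant: in the supremum norm of \<open>u\<close> it is a contraction on all of \<open>{0..}\<close> at once.\<close>

lemma solves_ode_exists_lipschitz:
  fixes F :: "'a::banach \<Rightarrow> 'a"
  assumes lip: "L-lipschitz_on UNIV F"
  shows "\<exists>w. solves_ode F w0 w"
proof -
  \<comment> \<open>Any \<open>K\<close> above \<open>L\<close> makes \<open>L / K\<close> a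
    contraction factor; adding \<open>1\<close> also keeps \<open>K\<close> positive when
    \<open>L = 0\<close>.\<close>
  define K where "K = L + 1"
  have L: "0 \<le> L" using lip by (rule lipschitz_on_nonneg)
  have K: "0 < K" using L by (simp add: K_def)
  have lipn: "norm (F a - F b) \<le> L * norm (a - b)" for a b
    using lipschitz_onD[OF lip, of a b] by (simp add: dist_norm)
  define G where "G u s = F (w0 + exp (K * s) *\<^sub>R u s)" for u :: "real \<Rightarrow> 'a" and s
  define I where "I u t = integral {0..t} (G u)" for u t
  \<comment> \<open>The Picard map in the rescaled variable. Freezing time at \<open>0\<close> for
    negative arguments makes it act on functions on all of \<open>real\<close>, so that the complete
    space of bounded continuous functions is available.\<close>
  define J where "J u t = exp (- K * max t 0) *\<^sub>R I u (max t 0)" for u t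
  have contG: "continuous_on A (G u)" if "continuous_on UNIV u" for u A
    unfolding G_def
    by (rule continuous_on_compose2[OF lipschitz_on_continuous_on[OF lip]])
      (auto intro!: continuous_intros continuous_on_subset[OF that])
  have Ider: "(I u has_vector_derivative G u t) (at t within {0..})"
    if "continuous_on UNIV u" "0 \<le> t" for u t
    unfolding I_def[abs_def]
    by (rule integral_has_vector_derivative_atLeast) (use that contG in auto)
  have contI: "continuous_on {0..} (I u)" if "continuous_on UNIV u" for u
    using Ider[OF that] by (auto simp: continuous_on_eq_continuous_within
        intro: has_vector_derivative_continuous)
  have contJ: "continuous_on UNIV (J u)" if "continuous_on UNIV u" for u
    unfolding J_def[abs_def]
    by (intro continuous_intros continuous_on_compose2[OF contI[OF that]]) auto
  \<comment> \<open>The unscaled trajectories differ by at most \<open>exp (K * s) * B\<close>;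
    integration gains the factor \<open>1 / K\<close>, and the weight \<open>exp (- K * t)\<close>
    cancels the exponential uniformly in \<open>t\<close>.\<close>
  have Jdiff: "norm (J u t - J v t) \<le> L / K * B"
    if u: "continuous_on UNIV u" and v: "continuous_on UNIV v"
      and B: "\<And>s. norm (u s - v s) \<le> B" for u v t B
  proof -
    define r where "r = max t 0"
    have r: "0 \<le> r" by (simp add: r_def)
    have B0: "0 \<le> B" using B[of 0] norm_ge_zero order_trans by blast
    have "norm (I u r - I v r) = norm (integral {0..r} (\<lambda>s. G u s - G v s))"
      unfolding I_def
      by (subst Henstock_Kurzweil_Integration.integral_diff) (auto intro!: integrable_continuous_interval contG u v)
    also have "\<dots> \<le> integral {0..r} (\<lambda>s. (L * B) * exp (K * s))"
    proof (rule integral_norm_bound_integral)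
      show "(\<lambda>s. G u s - G v s) integrable_on {0..r}"
        by (intro integrable_continuous_interval continuous_intros contG u v)
      show "(\<lambda>s. (L * B) * exp (K * s)) integrable_on {0..r}"
        by (intro integrable_continuous_interval continuous_intros)
      fix s assume "s \<in> {0..r}"
      have "norm (G u s - G v s) \<le> L * norm (exp (K * s) *\<^sub>R u s - exp (K * s) *\<^sub>R v s)"
        using lipn[of "w0 + exp (K * s) *\<^sub>R u s" "w0 + exp (K * s) *\<^sub>R v s"] by (simp add: G_def)
      also have "\<dots> = L * (exp (K * s) * norm (u s - v s))"
        by (simp flip: scaleR_diff_right)
      also have "\<dots> \<le> L * (exp (K * s) * B)"
        using L B by (intro mult_left_mono) auto
      finally show "norm (G u s - G v s) \<le> (L * B) * exp (K * s)" by (simp add: ac_simps)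
    qed
    also have "\<dots> = L * B / K * (exp (K * r) - 1)"
      using integral_scaled_exp[of K r "L * B"] K r by (intro integral_unique) auto
    finally have "norm (I u r - I v r) \<le> L * B / K * (exp (K * r) - 1)" .
    also have "\<dots> \<le> L * B / K * exp (K * r)"
      using L B0 K by (intro mult_left_mono) auto
    finally have "exp (- K * r) * norm (I u r - I v r) \<le> exp (- K * r) * (L * B / K * exp (K * r))"
      by (rule mult_left_mono) simp
    also have "\<dots> = L / K * B"
      by (simp add: exp_minus field_simps)
    finally show ?thesis
      unfolding J_def r_def[symmetric] by (simp flip: scaleR_diff_right)
  qed
  \<comment> \<open>From a constant trajectory the Picard map produces only linear growth, which the
    weight dominates. Comparison with the zero function then shows that \<open>J\<close> preserves
    boundedness.\<close>
  have J0: "norm (J (\<lambda>_. 0) t) \<le> norm (F w0) / K" for t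
  proof -
    define r where "r = max t 0"
    have r: "0 \<le> r" by (simp add: r_def)
    have "K * r \<le> exp (K * r)" using exp_ge_add_one_self[of "K * r"] by linarith
    then have "exp (- K * r) * r \<le> 1 / K"
      using K by (simp add: exp_minus field_simps)
    then have "(exp (- K * r) * r) * norm (F w0) \<le> 1 / K * norm (F w0)"
      by (rule mult_right_mono) simp
    then show ?thesis
      unfolding J_def r_def[symmetric] I_def G_def using r by simp
  qed
  have bc: "J (apply_bcontfun u) \<in> bcontfun" for u
  proof -
    have u: "continuous_on UNIV (apply_bcontfun u)" by simp
    have "norm (J u t) \<le> L / K * norm u + norm (F w0) / K" for t
    proof -
      have "norm (J u t - J (\<lambda>_. 0) t) \<le> L / K * norm u"
        by (rule Jdiff) (auto simp: norm_bounded)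
      then show ?thesis using J0[of t] norm_triangle_sub[of "J u t" "J (\<lambda>_. 0) t"] by linarith
    qed
    then show ?thesis
      unfolding bcontfun_def using contJ[OF u] by (auto simp: bounded_iff)
  qed
  have "\<exists>!u. Bcontfun (J (apply_bcontfun u)) = u"
  proof (rule banach_fix_type)
    show "0 \<le> L / K" "L / K < 1" using L K by (auto simp: K_def)
    show "\<forall>u v. dist (Bcontfun (J (apply_bcontfun u))) (Bcontfun (J (apply_bcontfun v))) \<le> L / K * dist u v"
    proof (intro allI dist_bound)
      fix u v :: "real \<Rightarrow>\<^sub>C 'a" and t
      show "dist (apply_bcontfun (Bcontfun (J u)) t) (apply_bcontfun (Bcontfun (J v)) t) \<le> L / K * dist u v"
        using Jdiff[of u v "dist u v" t] dist_bounded[of u _ v]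
        by (simp add: Bcontfun_inverse bc dist_norm)
    qed
  qed
  then obtain u where u: "Bcontfun (J (apply_bcontfun u)) = u" by auto
  then have ueq: "apply_bcontfun u = J (apply_bcontfun u)"
    using Bcontfun_inverse[OF bc] by metis
  have cu: "continuous_on UNIV (apply_bcontfun u)" by simp
  define w where "w t = w0 + I (apply_bcontfun u) t" for t
  \<comment> \<open>For nonnegative times the fixed-point equation undoes the rescaling, so the
    integrand \<open>G u t\<close> is \<open>F (w t)\<close>.\<close>
  have w: "w t = w0 + exp (K * t) *\<^sub>R u t" if "0 \<le> t" for t
    using that by (subst ueq) (simp add: w_def J_def mult_exp_exp)
  have "solves_ode F w0 w"
    unfolding solves_ode_def
  proof (intro conjI allI impI)
    show "w 0 = w0" by (simp add: w_def I_def)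
    fix t :: real assume t: "0 \<le> t"
    have "(w has_vector_derivative G u t) (at t within {0..})"
      unfolding w_def[abs_def] using Ider[OF cu t] by (auto intro!: derivative_eq_intros)
    then show "(w has_vector_derivative F (w t)) (at t within {0..})"
      by (simp add: G_def w[OF t])
  qed
  then show ?thesis by blast
qed

subsection \<open>Vector fields that are strongly monotone in an equivalent inner product\<close>

lemma inner_le_norm_square:
  fixes a b :: "'a::real_inner"
  assumes "norm b \<le> K * norm a"
  shows "inner b a \<le> K * (norm a)\<^sup>2"
proof -
  have "inner b a \<le> norm b * norm a" by (rule norm_cauchy_schwarz)
  also have "\<dots> \<le> K * norm a * norm a" by (intro mult_right_mono assms) simp
  finally show ?thesis by (simp add: power2_eq_square)
qed

text \<open>A small Euler step \<open>\<Phi> a = a + h *\<^sub>R F a\<close> contracts the norm induced by \<open>P\<close>, so some iterate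
  of it contracts the original norm.\<close>

lemma strongly_monotone_zero_exists:
  fixes F P :: "'a::euclidean_space \<Rightarrow> 'a"
  assumes lip: "L-lipschitz_on UNIV F"
    and P: "linear P" "\<And>a b. inner (P a) b = inner a (P b)"
    and k: "0 < k" "\<And>a. k * (norm a)\<^sup>2 \<le> inner (P a) a"
    and K: "\<And>a. norm (P a) \<le> K * norm a" "0 < K"
    and c: "0 < c" "\<And>a b. inner (P (F a - F b)) (a - b) \<le> - c * (norm (a - b))\<^sup>2"
  shows "\<exists>a. F a = 0"
proof -
  define V where "V a = inner (P a) a" for a
  have VK: "V a \<le> K * (norm a)\<^sup>2" for a
    unfolding V_def by (rule inner_le_norm_square[OF K(1)])
  \<comment> \<open>The first bound lets the second-order term of the Euler step consume at most
    half of the first-order decrease \<open>2 * h * c * (norm d)\<^sup>2\<close>; the second keeps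
    the factor \<open>q\<close> nonnegative.\<close>
  define h where "h = min (c / (K * L\<^sup>2 + 1)) (K / c)"
  have h: "0 < h" using K c by (simp add: h_def add_nonneg_pos)
  have "h \<le> c / (K * L\<^sup>2 + 1)" by (simp add: h_def)
  then have "h * (K * L\<^sup>2 + 1) \<le> c" using K by (simp add: pos_le_divide_eq add_nonneg_pos)
  then have hKL: "h * (K * L\<^sup>2) \<le> c" using h by (simp add: algebra_simps)
  have "h \<le> K / c" by (simp add: h_def)
  then have hc: "h * c / K \<le> 1" using K c by (simp add: field_simps)
  define q where "q = 1 - h * c / K"
  have q: "0 \<le> q" "q < 1" using h c K hc by (auto simp: q_def)
  define \<Phi> where "\<Phi> a = a + h *\<^sub>R F a" for a
  have step: "V (\<Phi> a - \<Phi> b) \<le> q * V (a - b)" for a b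
  proof -
    define d e where "d = a - b" and "e = F a - F b"
    have \<Phi>: "\<Phi> a - \<Phi> b = d + h *\<^sub>R e" by (simp add: \<Phi>_def d_def e_def algebra_simps)
    have ne: "norm e \<le> L * norm d"
      using lipschitz_on_normD[OF lip] by (simp add: d_def e_def)
    have "V (d + h *\<^sub>R e) = V d + 2 * h * inner (P e) d + h\<^sup>2 * V e"
      using P(2)[of d e]
      by (simp add: V_def linear_add[OF P(1)] linear_cmul[OF P(1)] inner_add inner_commute
          power2_eq_square algebra_simps)
    also have "\<dots> \<le> V d + 2 * h * (- c * (norm d)\<^sup>2) + h\<^sup>2 * (K * (L * norm d)\<^sup>2)"
    proof (intro add_mono mult_left_mono order_refl)
      show "inner (P e) d \<le> - c * (norm d)\<^sup>2" using c(2)[of a b] by (simp add: d_def e_def)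
      have "(norm e)\<^sup>2 \<le> (L * norm d)\<^sup>2" using ne by (rule power_mono) simp
      then show "V e \<le> K * (L * norm d)\<^sup>2"
        using VK[of e] K(2) by (meson mult_left_mono order_trans less_imp_le)
    qed (use h in auto)
    also have "\<dots> = V d - 2 * h * c * (norm d)\<^sup>2 + h * (h * (K * L\<^sup>2)) * (norm d)\<^sup>2"
      by (simp add: power2_eq_square algebra_simps)
    also have "\<dots> \<le> V d - 2 * h * c * (norm d)\<^sup>2 + h * c * (norm d)\<^sup>2"
      by (intro add_mono mult_right_mono mult_left_mono hKL order_refl) (use h in auto)
    also have "\<dots> = V d - h * c / K * (K * (norm d)\<^sup>2)" using K by (simp add: field_simps)
    also have "\<dots> \<le> V d - h * c / K * V d"
      by (intro diff_left_mono mult_left_mono VK) (use h c K in auto)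
    finally show ?thesis by (simp add: \<Phi> q_def d_def algebra_simps)
  qed
  have iter: "V ((\<Phi> ^^ n) a - (\<Phi> ^^ n) b) \<le> q ^ n * V (a - b)" for n a b
  proof (induction n)
    case (Suc n)
    have "V ((\<Phi> ^^ Suc n) a - (\<Phi> ^^ Suc n) b) \<le> q * V ((\<Phi> ^^ n) a - (\<Phi> ^^ n) b)"
      using step by simp
    also have "\<dots> \<le> q * (q ^ n * V (a - b))" by (rule mult_left_mono[OF Suc q(1)])
    finally show ?case by simp
  qed simp
  \<comment> \<open>Returning from \<open>V\<close> to the norm costs the ratio
    \<open>K / k\<close>. This choice absorbs it and leaves \<open>1 / 4\<close> for squared norms,
    hence \<open>1 / 2\<close> for norms.\<close>
  obtain N where N: "q ^ N < k / (4 * K)"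
    using real_arch_pow_inv[of "k / (4 * K)" q] k K q by auto
  have contr: "dist ((\<Phi> ^^ N) a) ((\<Phi> ^^ N) b) \<le> 1 / 2 * dist a b" for a b
  proof -
    have "k * (norm ((\<Phi> ^^ N) a - (\<Phi> ^^ N) b))\<^sup>2 \<le> q ^ N * V (a - b)"
      using k(2) iter unfolding V_def by (meson order_trans)
    also have "\<dots> \<le> q ^ N * (K * (norm (a - b))\<^sup>2)" by (intro mult_left_mono VK) (use q in auto)
    also have "\<dots> \<le> k / (4 * K) * (K * (norm (a - b))\<^sup>2)"
      by (intro mult_right_mono) (use N K in auto)
    also have "\<dots> = k * (1 / 2 * norm (a - b))\<^sup>2" using K by (simp add: power2_eq_square)
    finally have "(norm ((\<Phi> ^^ N) a - (\<Phi> ^^ N) b))\<^sup>2 \<le> (1 / 2 * norm (a - b))\<^sup>2"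
      using k(1) by (simp only: mult_le_cancel_left_pos)
    then have "norm ((\<Phi> ^^ N) a - (\<Phi> ^^ N) b) \<le> 1 / 2 * norm (a - b)"
      by (rule power2_le_imp_le) simp
    then show ?thesis by (simp add: dist_norm)
  qed
  have "\<exists>!a. (\<Phi> ^^ N) a = a"
    by (rule banach_fix_type[of "1 / 2"]) (use contr in auto)
  then obtain a where a: "(\<Phi> ^^ N) a = a" and uniq: "\<And>b. (\<Phi> ^^ N) b = b \<Longrightarrow> b = a"
    by blast
  \<comment> \<open>\<open>\<Phi>\<close> commutes with its iterates, so it maps the only fixed
    point of the iterate to a fixed point of the iterate.\<close>
  have "(\<Phi> ^^ N) (\<Phi> a) = \<Phi> a" using a by (metis funpow_swap1)
  then have "\<Phi> a = a" by (rule uniq)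
  then show ?thesis using h by (auto simp: \<Phi>_def)
qed

text \<open>A Gronwall argument: as \<open>V\<close> is at most \<open>K\<close> times the squared
  norm, the dissipation gives \<open>V' \<le> - 2 * (c / K) * V\<close> along trajectories.
  Comparing \<open>V\<close> with the squared norm at both times produces
  \<open>sqrt (K / k)\<close>.\<close>

lemma strongly_monotone_decay:
  fixes F P :: "'a::euclidean_space \<Rightarrow> 'a"
  assumes P: "linear P" "\<And>a b. inner (P a) b = inner a (P b)"
    and k: "0 < k" "\<And>a. k * (norm a)\<^sup>2 \<le> inner (P a) a"
    and K: "\<And>a. norm (P a) \<le> K * norm a" "0 < K"
    and c: "0 < c" "\<And>a b. inner (P (F a - F b)) (a - b) \<le> - c * (norm (a - b))\<^sup>2"
    and ws: "F ws = 0" and w: "solves_ode F w0 w" and t: "0 \<le> t"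
  shows "norm (w t - ws) \<le> sqrt (K / k) * exp (- (c / K) * t) * norm (w 0 - ws)"
proof -
  define V where "V a = inner (P a) a" for a
  define \<rho> where "\<rho> = c / K"
  have VK: "V a \<le> K * (norm a)\<^sup>2" for a
    unfolding V_def by (rule inner_le_norm_square[OF K(1)])
  have bP: "bounded_linear P" using P(1) by (simp add: linear_conv_bounded_linear)
  have wder: "(w has_vector_derivative F (w s)) (at s within {0..})" if "0 \<le> s" for s
    using w that by (simp add: solves_ode_def)
  define U where "U s = exp (2 * \<rho> * s) * V (w s - ws)" for s
  have Uder: "(U has_real_derivative
      exp (2 * \<rho> * s) * (2 * \<rho> * V (w s - ws) + 2 * inner (P (F (w s))) (w s - ws)))
      (at s within {0..})" if "0 \<le> s" for s
  proof -
    have d: "((\<lambda>s. w s - ws) has_vector_derivative F (w s)) (at s within {0..})"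
      using wder[OF that] by (auto intro!: derivative_eq_intros)
    have "((\<lambda>s. V (w s - ws)) has_vector_derivative
        (inner (P (w s - ws)) (F (w s)) + inner (P (F (w s))) (w s - ws))) (at s within {0..})"
      unfolding V_def
      by (rule bounded_bilinear.has_vector_derivative[OF bounded_bilinear_inner
          bounded_linear.has_vector_derivative[OF bP d] d])
    moreover have "inner (P (w s - ws)) (F (w s)) = inner (P (F (w s))) (w s - ws)"
      by (metis P(2) inner_commute)
    ultimately have "((\<lambda>s. V (w s - ws)) has_real_derivative 2 * inner (P (F (w s))) (w s - ws))
        (at s within {0..})"
      by (simp add: has_real_derivative_iff_has_vector_derivative)
    then show ?thesis
      unfolding U_def[abs_def]
      by (auto intro!: derivative_eq_intros simp: algebra_simps)
  qed
  have "U t \<le> U 0"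
  proof (cases "t = 0")
    case False
    show ?thesis
    \<comment> \<open>The derivative within \<open>{0..}\<close> is two-sided only at positive
      times; the form for open intervals asks for mere continuity at the endpoints.\<close>
    proof (rule DERIV_nonpos_imp_decreasing_open[of 0 t U])
      show "0 \<le> t" by (rule t)
      show "continuous_on {0..t} U"
        by (rule DERIV_continuous_on)
          (use Uder in \<open>auto intro!: DERIV_subset[OF Uder, of _ "{0..t}"]\<close>)
      fix s assume s: "0 < s" "s < t"
      have "2 * \<rho> * V (w s - ws) + 2 * inner (P (F (w s))) (w s - ws)
          \<le> 2 * \<rho> * (K * (norm (w s - ws))\<^sup>2) + 2 * (- c * (norm (w s - ws))\<^sup>2)"
        using c(2)[of "w s" ws] ws c(1) K(2)
        by (intro add_mono mult_left_mono VK) (auto simp: \<rho>_def)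
      also have "\<dots> = 0" using K(2) by (simp add: \<rho>_def)
      finally have "exp (2 * \<rho> * s) * (2 * \<rho> * V (w s - ws) + 2 * inner (P (F (w s))) (w s - ws)) \<le> 0"
        by (simp add: mult_nonneg_nonpos)
      moreover have "at s within {0..} = at s"
        using s by (intro at_within_interior) simp
      ultimately show "\<exists>y. (U has_real_derivative y) (at s) \<and> y \<le> 0"
        using Uder[of s] s by auto
    qed
  qed simp
  then have "exp (2 * \<rho> * t) * V (w t - ws) \<le> V (w 0 - ws)" by (simp add: U_def)
  then have "V (w t - ws) \<le> exp (- 2 * \<rho> * t) * V (w 0 - ws)"
    by (simp add: exp_minus field_simps)
  also have "\<dots> \<le> exp (- 2 * \<rho> * t) * (K * (norm (w 0 - ws))\<^sup>2)"
    by (intro mult_left_mono VK) simp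
  finally have "k * (norm (w t - ws))\<^sup>2 \<le> exp (- 2 * \<rho> * t) * (K * (norm (w 0 - ws))\<^sup>2)"
    using k(2)[of "w t - ws"] by (simp add: V_def)
  then have "(norm (w t - ws))\<^sup>2 \<le> K / k * exp (- 2 * \<rho> * t) * (norm (w 0 - ws))\<^sup>2"
    using k(1) by (simp add: field_simps)
  also have "\<dots> = (sqrt (K / k) * exp (- \<rho> * t) * norm (w 0 - ws))\<^sup>2"
    using k(1) K(2) by (simp add: power_mult_distrib flip: exp_double)
  finally show ?thesis
    unfolding \<rho>_def by (rule power2_le_imp_le) (use k K in auto)
qed

subsection \<open>Gradients and convexity\<close>

lemma GDERIV_unique:
  assumes "GDERIV f x :> a" "GDERIV f x :> b"
  shows "a = b"
proof -
  have "(\<lambda>h. inner h a) = (\<lambda>h. inner h b)"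
    using assms unfolding gderiv_def by (rule has_derivative_unique)
  then show ?thesis by (metis vector_eq_ldot)
qed

lemma gradient_eqI: "GDERIV f x :> D \<Longrightarrow> gradient f x = D"
  unfolding gradient_def by (blast intro: GDERIV_unique)

text \<open>Riesz representation: the vector representing the derivative is its adjoint applied to
  \<open>1\<close>.\<close>

lemma GDERIV_gradient:
  fixes f :: "'a::euclidean_space \<Rightarrow> real"
  assumes "f differentiable (at x)"
  shows "GDERIV f x :> gradient f x"
proof -
  obtain f' where f': "(f has_derivative f') (at x)"
    using assms by (auto simp: differentiable_def)
  have lin: "linear f'" using f' by (rule has_derivative_linear)
  have "f' h = inner h (adjoint f' 1)" for h
    using adjoint_works[OF lin, of h 1] by simp
  then have "GDERIV f x :> adjoint f' 1"
    unfolding gderiv_def using f' by (metis (no_types, lifting) ext)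
  then show ?thesis using gradient_eqI by metis
qed

text \<open>Restriction to the line through \<open>x\<close> and \<open>y\<close> reduces this to
  the tangent inequality in one real variable.\<close>

lemma convex_on_GDERIV_le:
  fixes h :: "'a::real_inner \<Rightarrow> real"
  assumes cvx: "convex_on UNIV h" and D: "GDERIV h x :> D"
  shows "h x + inner D (y - x) \<le> h y"
proof -
  define \<phi> where "\<phi> t = h (x + t *\<^sub>R (y - x))" for t :: real
  have "convex_on UNIV \<phi>"
  proof (rule convex_onI)
    fix t a b :: real assume "0 < t" "t < 1"
    have "x + ((1 - t) * a + t * b) *\<^sub>R (y - x)
        = (1 - t) *\<^sub>R (x + a *\<^sub>R (y - x)) + t *\<^sub>R (x + b *\<^sub>R (y - x))"
      by (simp add: algebra_simps)
    then show "\<phi> ((1 - t) *\<^sub>R a + t *\<^sub>R b) \<le> (1 - t) * \<phi> a + t * \<phi> b"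
      using convex_onD[OF cvx, of t "x + a *\<^sub>R (y - x)" "x + b *\<^sub>R (y - x)"] \<open>0 < t\<close> \<open>t < 1\<close>
      by (simp add: \<phi>_def)
  qed simp
  moreover have "(\<phi> has_real_derivative inner D (y - x)) (at 0)"
  proof -
    have "(h has_derivative (\<lambda>v. inner v D)) (at (x + 0 *\<^sub>R (y - x)))"
      using D by (simp add: gderiv_def)
    moreover have "((\<lambda>t. x + t *\<^sub>R (y - x)) has_derivative (\<lambda>t. t *\<^sub>R (y - x))) (at 0)"
      by (auto intro!: derivative_eq_intros)
    ultimately have "(\<phi> has_derivative (\<lambda>t. inner (t *\<^sub>R (y - x)) D)) (at 0)"
      unfolding \<phi>_def[abs_def] by (rule has_derivative_compose[rotated])
    then show ?thesis by (simp add: has_field_derivative_def inner_commute mult.commute[of _ "inner _ _"])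
  qed
  ultimately have "inner D (y - x) * (1 - 0) \<le> \<phi> 1 - \<phi> 0"
    by (intro convex_on_imp_above_tangent[of UNIV]) auto
  then show ?thesis by (simp add: \<phi>_def)
qed

text \<open>The tangent inequalities of \<open>f x - m / 2 * (norm x)\<^sup>2\<close> from
  \<open>x\<close> to \<open>y\<close> and from \<open>y\<close> to \<open>x\<close> are added, so
  that the function values cancel.\<close>

lemma strongly_convex_gradient_monotone:
  fixes f :: "'a::euclidean_space \<Rightarrow> real"
  assumes diff: "\<And>x. f differentiable (at x)" and sc: "strongly_convex m f"
  shows "m * (norm (x - y))\<^sup>2 \<le> inner (gradient f x - gradient f y) (x - y)"
proof -
  define h where "h x = f x - m / 2 * (norm x)\<^sup>2" for x
  have "GDERIV h x :> gradient f x - m *\<^sub>R x" for x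
  proof -
    have "GDERIV (\<lambda>x. m / 2 * (norm x)\<^sup>2) x :> m *\<^sub>R x"
      unfolding gderiv_def power2_norm_eq_inner
      by (auto intro!: derivative_eq_intros simp: inner_commute)
    then show ?thesis
      unfolding h_def[abs_def] by (intro GDERIV_diff GDERIV_gradient diff)
  qed
  moreover have "convex_on UNIV h" using sc by (simp add: strongly_convex_def h_def[abs_def])
  ultimately have le: "h a + inner (gradient f a - m *\<^sub>R a) (b - a) \<le> h b" for a b
    by (metis convex_on_GDERIV_le)
  show ?thesis
    using le[of x y] le[of y x]
    by (simp add: power2_norm_eq_inner inner_diff inner_commute algebra_simps)
qed

section \<open>Lower semicontinuity and growth of extended-valued functions\<close>

lemma lsc_fun_seq_le:
  fixes g :: "'a::metric_space \<Rightarrow> ereal"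
  assumes lsc: "lsc_fun g" and X: "X \<longlonglongrightarrow> x" and r: "r \<longlonglongrightarrow> a"
    and le: "\<And>n. g (X n) \<le> ereal (r n)"
  shows "g x \<le> ereal a"
proof (rule ccontr)
  assume "\<not> ?thesis"
  then have "ereal a < g x" by simp
  then obtain b where b: "a < b" "ereal b < g x"
    using ereal_dense2 by (metis ereal_less(2) less_ereal.simps(1))
  have "ereal b < Liminf (at x) g"
    using lsc b(2) unfolding lsc_fun_def by (metis less_le_trans)
  then have "\<forall>\<^sub>F u in at x. ereal b < g u"
    by (rule less_LiminfD)
  \<comment> \<open>\<open>lsc_fun\<close> speaks of punctured neighbourhoods; the point itself is
    added because the sequence may hit its limit.\<close>
  then have "\<forall>\<^sub>F u in nhds x. ereal b < g u"
    using b(2) by (auto simp: eventually_at_filter elim!: eventually_mono)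
  then have "\<forall>\<^sub>F n in sequentially. ereal b < g (X n)"
    using X by (rule eventually_compose_filterlim)
  then have "\<forall>\<^sub>F n in sequentially. b \<le> r n"
    by eventually_elim (use le in \<open>metis ereal_less_eq(3) less_imp_le order_trans\<close>)
  then have "b \<le> a"
    using r by (intro tendsto_lowerbound) auto
  then show False using b(1) by simp
qed

text \<open>Otherwise points with values below \<open>- n\<close> would accumulate at a point where
  lower semicontinuity forces the value \<open>-\<infinity>\<close>.\<close>

lemma lsc_fun_bounded_below_compact:
  fixes g :: "'a::metric_space \<Rightarrow> ereal"
  assumes lsc: "lsc_fun g" and fin: "\<And>x. g x \<noteq> -\<infinity>" and S: "compact S"
  shows "\<exists>c. \<forall>x\<in>S. ereal c \<le> g x"
proof (rule ccontr)
  assume "\<not> ?thesis"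
  then have "\<forall>n::nat. \<exists>x\<in>S. g x \<le> ereal (- real n)" by (meson linorder_le_cases)
  then obtain X where X: "\<And>n. X n \<in> S" "\<And>n. g (X n) \<le> ereal (- real n)" by metis
  obtain x s where s: "strict_mono s" "(X \<circ> s) \<longlonglongrightarrow> x"
    using S X(1) unfolding compact_def by metis
  have "g x \<le> ereal (- real N)" for N
  proof (rule lsc_fun_seq_le[OF lsc])
    show "(\<lambda>n. (X \<circ> s) (n + N)) \<longlonglongrightarrow> x" using s(2) by (rule LIMSEQ_ignore_initial_segment)
    show "(\<lambda>_. - real N) \<longlonglongrightarrow> - real N" by simp
    fix n
    have "n + N \<le> s (n + N)" using s(1) by (rule seq_suble)
    then have "ereal (- real (s (n + N))) \<le> ereal (- real N)" by simp
    then show "g ((X \<circ> s) (n + N)) \<le> ereal (- real N)"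
      using X(2)[of "s (n + N)"] by (metis comp_apply order_trans)
  qed
  moreover obtain N where "\<not> g x \<le> ereal (- real N)"
  proof (cases "g x")
    case (real r)
    obtain N where "- r < real N" using reals_Archimedean2 by blast
    then show ?thesis using real that[of N] by simp
  qed (use fin[of x] that in auto)
  ultimately show False by blast
qed

text \<open>A point far from \<open>x0\<close> is compared, along the segment to \<open>x0\<close>, with the point of that segment
  on the unit sphere around \<open>x0\<close>.\<close>

lemma convex_fun_linear_lower_bound:
  fixes g :: "'a::euclidean_space \<Rightarrow> ereal"
  assumes proper: "proper_fun g" and lsc: "lsc_fun g" and cvx: "convex_fun g"
  shows "\<exists>C\<ge>0. \<exists>x0. \<forall>u. ereal (- C * (1 + norm (u - x0))) \<le> g u"
proof -
  have fin: "\<And>x. g x \<noteq> -\<infinity>" using proper by (simp add: proper_fun_def)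
  obtain x0 b where x0: "g x0 = ereal b"
    using proper unfolding proper_fun_def by (metis ereal_cases)
  obtain a where a: "\<And>x. x \<in> cball x0 1 \<Longrightarrow> ereal a \<le> g x"
    using lsc_fun_bounded_below_compact[OF lsc fin compact_cball] by metis
  \<comment> \<open>The term \<open>\<bar>a\<bar>\<close> covers the unit ball; outside it,
    convexity bounds \<open>g u\<close> below by \<open>r * a - (r - 1) * b\<close>, whose slope in
    \<open>r\<close> is controlled by both terms.\<close>
  define C where "C = \<bar>a\<bar> + \<bar>b\<bar>"
  have C: "0 \<le> C" by (simp add: C_def)
  have "ereal (- C * (1 + norm (u - x0))) \<le> g u" for u
  proof (cases "norm (u - x0) \<le> 1")
    case True
    then have "ereal a \<le> g u" by (intro a) (simp add: dist_norm norm_minus_commute)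
    moreover have "0 \<le> C * norm (u - x0)" "- C \<le> a" by (auto simp: C_def)
    then have "- C * (1 + norm (u - x0)) \<le> a" by (simp add: algebra_simps)
    ultimately show ?thesis by (meson ereal_less_eq(3) order_trans)
  next
    case False
    define r where "r = norm (u - x0)"
    have r: "1 < r" using False by (simp add: r_def)
    define p where "p = (1 - 1 / r) *\<^sub>R x0 + (1 / r) *\<^sub>R u"
    have "p - x0 = (1 / r) *\<^sub>R (u - x0)" by (simp add: p_def algebra_simps)
    then have "norm (p - x0) = 1" using r by (auto simp: r_def)
    then have "ereal a \<le> g p" by (intro a) (simp add: dist_norm norm_minus_commute)
    also have "g p \<le> ereal (1 - 1 / r) * g x0 + ereal (1 / r) * g u"
      using cvx r unfolding convex_fun_def p_def by simp
    finally have *: "ereal a \<le> ereal (1 - 1 / r) * g x0 + ereal (1 / r) * g u" .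
    show ?thesis
    proof (cases "g u")
      case (real s)
      then have "a \<le> (1 - 1 / r) * b + (1 / r) * s" using * x0 by simp
      then have "r * a \<le> r * ((1 - 1 / r) * b + (1 / r) * s)" using r by simp
      also have "\<dots> = (r - 1) * b + s" using r by (simp add: field_simps)
      finally have "r * a - (r - 1) * b \<le> s" by simp
      moreover have "- \<bar>a\<bar> * r \<le> r * a" using r by (simp add: abs_real_def)
      moreover have "(r - 1) * b \<le> (r - 1) * \<bar>b\<bar>" using r by (intro mult_left_mono) auto
      ultimately have "- C * (1 + r) \<le> s" by (simp add: C_def algebra_simps)
      then show ?thesis by (simp add: real r_def)
    qed (use fin[of u] in auto)
  qed
  then show ?thesis using C by blast
qed

subsection \<open>Proximal operator and Moreau envelope\<close>

text \<open>If \<open>g z\<close> were \<open>\<infinity>\<close>, the subgradient inequality would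
  make \<open>g\<close> infinite everywhere, against properness.\<close>

lemma subdifferential_finite:
  assumes "proper_fun g" "y \<in> subdifferential g z"
  shows "\<bar>g z\<bar> \<noteq> \<infinity>"
proof -
  obtain u where u: "g u \<noteq> \<infinity>" using assms(1) by (auto simp: proper_fun_def)
  have "g z + ereal (inner y (u - z)) \<le> g u" using assms(2) by (simp add: subdifferential_def)
  then have "g z \<noteq> \<infinity>" using u by auto
  then show ?thesis using assms(1) by (auto simp: proper_fun_def)
qed

lemma subdifferential_monotone:
  assumes proper: "proper_fun g"
    and y: "y1 \<in> subdifferential g z1" "y2 \<in> subdifferential g z2"
  shows "0 \<le> inner (y1 - y2) (z1 - z2)"
proof -
  obtain a1 a2 where a: "g z1 = ereal a1" "g z2 = ereal a2"
    using subdifferential_finite[OF proper] y by (metis ereal_cases ereal_infinity_cases abs_ereal.simps(2,3))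
  have "g z1 + ereal (inner y1 (z2 - z1)) \<le> g z2" "g z2 + ereal (inner y2 (z1 - z2)) \<le> g z1"
    using y by (auto simp: subdifferential_def)
  then have "a1 + inner y1 (z2 - z1) \<le> a2" "a2 + inner y2 (z1 - z2) \<le> a1"
    by (auto simp: a)
  then show ?thesis by (simp add: inner_diff algebra_simps)
qed

context
  fixes g :: "'a::euclidean_space \<Rightarrow> ereal" and \<mu> :: real
  assumes proper: "proper_fun g" and lsc: "lsc_fun g" and cvx: "convex_fun g" and \<mu>: "0 < \<mu>"
begin

text \<open>A minimising sequence is Cauchy because the quadratic term makes the objective uniformly
  convex (parallelogram law).\<close>

lemma prox_objective_attains_min:
  "\<exists>p. \<forall>u. g p + ereal (1 / (2 * \<mu>) * (norm (p - v))\<^sup>2) \<le> g u + ereal (1 / (2 * \<mu>) * (norm (u - v))\<^sup>2)"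
proof -
  have fin: "\<And>x. g x \<noteq> -\<infinity>" using proper by (simp add: proper_fun_def)
  define q where "q u = 1 / (2 * \<mu>) * (norm (u - v))\<^sup>2" for u
  define D where "D = {u. g u \<noteq> \<infinity>}"
  define h where "h u = real_of_ereal (g u)" for u
  have gh: "g u = ereal (h u)" if "u \<in> D" for u
    using that fin[of u] by (cases "g u") (auto simp: D_def h_def)
  have D: "D \<noteq> {}" using proper by (auto simp: D_def proper_fun_def)
  obtain C x0 where C: "0 \<le> C" "\<And>u. ereal (- C * (1 + norm (u - x0))) \<le> g u"
    using convex_fun_linear_lower_bound[OF proper lsc cvx] by metis
  \<comment> \<open>The quadratic term beats the linear decay of \<open>g\<close>: completing the
    square gives \<open>C * norm (u - v) \<le> q u + \<mu> * C\<^sup>2 / 2\<close>.\<close>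
  have "- C * (1 + norm (v - x0)) - \<mu> * C\<^sup>2 / 2 \<le> h u + q u" if "u \<in> D" for u
  proof -
    have "norm (u - x0) \<le> norm (u - v) + norm (v - x0)" by norm
    then have "C * (1 + norm (u - x0)) \<le> C * (1 + (norm (u - v) + norm (v - x0)))"
      using C(1) by (intro mult_left_mono add_left_mono)
    moreover have "- C * (1 + norm (u - x0)) \<le> h u" using C(2)[of u] gh[OF that] by simp
    moreover have "C * norm (u - v) \<le> q u + \<mu> * C\<^sup>2 / 2"
    proof -
      have "0 \<le> (norm (u - v) - \<mu> * C)\<^sup>2 / (2 * \<mu>)" using \<mu> by simp
      also have "\<dots> = q u + \<mu> * C\<^sup>2 / 2 - C * norm (u - v)"
        using \<mu> by (simp add: q_def field_simps power2_eq_square)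
      finally show ?thesis by simp
    qed
    ultimately show ?thesis by (simp add: algebra_simps)
  qed
  then have bdd: "bdd_below ((\<lambda>u. h u + q u) ` D)" by (auto intro!: bdd_belowI)
  define m where "m = (INF u\<in>D. h u + q u)"
  have m_le: "m \<le> h u + q u" if "u \<in> D" for u
    unfolding m_def by (rule cINF_lower[OF bdd that])
  define \<delta> where "\<delta> n = 1 / real (Suc n)" for n
  have "\<exists>u\<in>D. h u + q u < m + \<delta> n" for n
    using cINF_less_iff[OF D bdd, of "m + \<delta> n"] by (simp add: m_def \<delta>_def)
  then obtain X where X: "\<And>n. X n \<in> D" "\<And>n. h (X n) + q (X n) < m + \<delta> n"
    by metis
  have mid: "(norm (a - b))\<^sup>2 / (8 * \<mu>) \<le> (h a + q a + h b + q b) / 2 - m" if "a \<in> D" "b \<in> D" for a b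
  proof -
    define w where "w = (1 - 1 / 2) *\<^sub>R a + (1 / 2 :: real) *\<^sub>R b"
    have "(1 / 2 :: real) \<in> {0..1}" by simp
    then have "g w \<le> ereal (1 - 1 / 2) * g a + ereal (1 / 2) * g b"
      using cvx unfolding convex_fun_def w_def by blast
    also have "\<dots> = ereal ((h a + h b) / 2)" by (simp add: gh that add_divide_distrib)
    finally have gw: "g w \<le> ereal ((h a + h b) / 2)" .
    then have w: "w \<in> D" by (auto simp: D_def)
    have wv: "(norm (w - v))\<^sup>2 = ((norm (a - v))\<^sup>2 + (norm (b - v))\<^sup>2) / 2 - (norm (a - b))\<^sup>2 / 4"
    proof -
      have "w - v = (1 / 2) *\<^sub>R ((a - v) + (b - v))"
        by (simp add: w_def algebra_simps flip: scaleR_add_left)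
      then have "(norm (w - v))\<^sup>2 = (norm ((a - v) + (b - v)))\<^sup>2 / 4"
        by (simp add: power_mult_distrib power2_eq_square)
      moreover have "(norm ((a - v) + (b - v)))\<^sup>2 + (norm (a - b))\<^sup>2
          = 2 * (norm (a - v))\<^sup>2 + 2 * (norm (b - v))\<^sup>2"
        unfolding power2_norm_eq_inner by (simp add: inner_diff inner_add inner_commute algebra_simps)
      ultimately show ?thesis by (simp add: field_simps)
    qed
    have "q w = (q a + q b) / 2 - (norm (a - b))\<^sup>2 / (8 * \<mu>)"
      using \<mu> unfolding q_def wv by (simp add: field_simps)
    moreover have "h w \<le> (h a + h b) / 2" using gw gh[OF w] by simp
    ultimately show ?thesis using m_le[OF w] by (simp add: field_simps)
  qed
  have "Cauchy X"
  proof (rule metric_CauchyI)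
    fix e :: real assume e: "0 < e"
    obtain N where N: "8 * \<mu> / e\<^sup>2 < real N" using reals_Archimedean2 by blast
    have "0 < 8 * \<mu> / e\<^sup>2" using \<mu> e by simp
    then have N0: "0 < real N" using N by linarith
    have "dist (X n) (X k) < e" if "N \<le> n" "N \<le> k" for n k
    proof -
      have "\<delta> n \<le> 1 / real N" "\<delta> k \<le> 1 / real N"
        using that N0 unfolding \<delta>_def by (auto intro!: divide_left_mono)
      then have "h (X n) + q (X n) \<le> m + 1 / real N" "h (X k) + q (X k) \<le> m + 1 / real N"
        using X(2)[of n] X(2)[of k] by (auto elim: order_trans[OF less_imp_le])
      then have "(h (X n) + q (X n) + h (X k) + q (X k)) / 2 - m \<le> 1 / real N"
        unfolding add_divide_distrib by linarith
      then have "(norm (X n - X k))\<^sup>2 / (8 * \<mu>) \<le> 1 / real N"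
        using mid[OF X(1) X(1), of n k] by (rule order_trans[rotated])
      also have "\<dots> < e\<^sup>2 / (8 * \<mu>)" using N N0 \<mu> e by (simp add: field_simps)
      finally have "(norm (X n - X k))\<^sup>2 < e\<^sup>2" using \<mu> by (simp add: divide_less_cancel)
      then show ?thesis using e by (simp add: dist_norm power_less_imp_less_base)
    qed
    then show "\<exists>N. \<forall>n\<ge>N. \<forall>k\<ge>N. dist (X n) (X k) < e" by blast
  qed
  then obtain p where p: "X \<longlonglongrightarrow> p" using Cauchy_convergent convergent_def by blast
  \<comment> \<open>The quadratic part is continuous and is moved to the right-hand side, so lower
    semicontinuity is applied to \<open>g\<close> alone.\<close>
  have "g p \<le> ereal (m - q p)"
  proof (rule lsc_fun_seq_le[OF lsc p])
    have "(\<lambda>n. m + \<delta> n - q (X n)) \<longlonglongrightarrow> m + 0 - q p"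
      unfolding q_def \<delta>_def by (intro tendsto_intros p LIMSEQ_Suc lim_1_over_n)
    then show "(\<lambda>n. m + \<delta> n - q (X n)) \<longlonglongrightarrow> m - q p" by simp
    show "g (X n) \<le> ereal (m + \<delta> n - q (X n))" for n
      using X(2)[of n] by (simp add: gh[OF X(1)])
  qed
  then have "g p + ereal (q p) \<le> ereal m" by (cases "g p") auto
  moreover have "ereal m \<le> g u + ereal (q u)" for u
    using m_le[of u] gh[of u] by (cases "u \<in> D") (auto simp: D_def)
  ultimately show ?thesis unfolding q_def by (meson order_trans)
qed

lemma prox_minimal:
  "g (prox \<mu> g v) + ereal (1 / (2 * \<mu>) * (norm (prox \<mu> g v - v))\<^sup>2)
     \<le> g u + ereal (1 / (2 * \<mu>) * (norm (u - v))\<^sup>2)"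
proof -
  let ?\<phi> = "\<lambda>u. g u + ereal (1 / (2 * \<mu>) * (norm (u - v))\<^sup>2)"
  obtain p where "\<forall>u. ?\<phi> p \<le> ?\<phi> u" using prox_objective_attains_min by blast
  then have "is_arg_min ?\<phi> (\<lambda>_. True) p" by (auto simp: is_arg_min_def not_less)
  then have "is_arg_min ?\<phi> (\<lambda>_. True) (prox \<mu> g v)"
    unfolding prox_def arg_min_def by (rule someI)
  then show ?thesis by (auto simp: is_arg_min_def not_less)
qed

lemma prox_finite: "\<bar>g (prox \<mu> g v)\<bar> \<noteq> \<infinity>"
proof -
  obtain u where u: "g u \<noteq> \<infinity>" using proper by (auto simp: proper_fun_def)
  then have "g (prox \<mu> g v) \<noteq> \<infinity>" using prox_minimal[of v u] by auto
  then show ?thesis using proper by (auto simp: proper_fun_def)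
qed

text \<open>Fermat's rule. The minimiser is compared with the point at parameter \<open>t\<close> on
  the segment towards \<open>u\<close>; after division by \<open>t\<close>, the subgradient
  inequality holds up to an error linear in \<open>t\<close>, which vanishes as \<open>t\<close>
  tends to \<open>0\<close>.\<close>

lemma prox_subdifferential:
  "(1 / \<mu>) *\<^sub>R (v - prox \<mu> g v) \<in> subdifferential g (prox \<mu> g v)"
  unfolding subdifferential_def
proof (intro CollectI allI)
  fix u
  define p where "p = prox \<mu> g v"
  obtain a where a: "g p = ereal a" using prox_finite[of v] by (auto simp: p_def)
  show "g (prox \<mu> g v) + ereal (inner ((1 / \<mu>) *\<^sub>R (v - prox \<mu> g v)) (u - prox \<mu> g v)) \<le> g u"
    unfolding p_def[symmetric]
  proof (cases "g u")
    case (real b)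
    define i N where "i = inner (v - p) (u - p)" and "N = (norm (u - p))\<^sup>2"
    have le: "a + 1 / \<mu> * i \<le> b + t / (2 * \<mu>) * N" if t: "0 < t" "t \<le> 1" for t
    proof -
      define z where "z = (1 - t) *\<^sub>R p + t *\<^sub>R u"
      have "g z \<le> ereal (1 - t) * g p + ereal t * g u"
        using cvx t unfolding convex_fun_def z_def by simp
      also have "\<dots> = ereal ((1 - t) * a + t * b)" by (simp add: a real)
      finally have gz: "g z \<le> ereal ((1 - t) * a + t * b)" .
      have "g p + ereal (1 / (2 * \<mu>) * (norm (p - v))\<^sup>2) \<le> g z + ereal (1 / (2 * \<mu>) * (norm (z - v))\<^sup>2)"
        unfolding p_def by (rule prox_minimal)
      also have "\<dots> \<le> ereal ((1 - t) * a + t * b) + ereal (1 / (2 * \<mu>) * (norm (z - v))\<^sup>2)"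
        by (intro add_mono gz order_refl)
      finally have "a + 1 / (2 * \<mu>) * (norm (p - v))\<^sup>2
          \<le> (1 - t) * a + t * b + 1 / (2 * \<mu>) * (norm (z - v))\<^sup>2" by (simp add: a)
      moreover have zn: "(norm (z - v))\<^sup>2 = (norm (p - v))\<^sup>2 - 2 * t * i + t\<^sup>2 * N"
      proof -
        have zv: "z - v = (p - v) + t *\<^sub>R (u - p)" by (simp add: z_def algebra_simps)
        show ?thesis
          unfolding i_def N_def power2_norm_eq_inner zv
          by (simp add: inner_add inner_diff inner_commute power2_eq_square algebra_simps)
      qed
      have "1 / (2 * \<mu>) * (norm (z - v))\<^sup>2
          = 1 / (2 * \<mu>) * (norm (p - v))\<^sup>2 - t * (1 / \<mu> * i) + t * (t / (2 * \<mu>) * N)"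
        using \<mu> unfolding zn by (simp add: field_simps power2_eq_square)
      ultimately have "t * (a + 1 / \<mu> * i) \<le> t * (b + t / (2 * \<mu>) * N)"
        unfolding distrib_left left_diff_distrib by linarith
      then show ?thesis using t by simp
    qed
    have "((\<lambda>t. b + t / (2 * \<mu>) * N) \<longlongrightarrow> b + 0 / (2 * \<mu>) * N) (at_right 0)"
      using \<mu> by (intro tendsto_intros) auto
    moreover have "\<forall>\<^sub>F t in at_right 0. a + 1 / \<mu> * i \<le> b + t / (2 * \<mu>) * N"
      unfolding eventually_at_right_field using le by (intro exI[of _ 1]) auto
    ultimately have "a + 1 / \<mu> * i \<le> b + 0 / (2 * \<mu>) * N"
      by (intro tendsto_lowerbound) auto
    then show "g p + ereal (inner ((1 / \<mu>) *\<^sub>R (v - p)) (u - p)) \<le> g u"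
      by (simp add: a real i_def)
  qed (use proper in \<open>auto simp: proper_fun_def\<close>)
qed

text \<open>Resolvent property: the subgradients at \<open>p\<close> and \<open>z\<close> differ by
  \<open>(- 1 / \<mu>) *\<^sub>R (p - z)\<close>, which monotonicity allows only for
  \<open>p = z\<close>.\<close>

lemma prox_eqI:
  assumes "y \<in> subdifferential g z"
  shows "prox \<mu> g (z + \<mu> *\<^sub>R y) = z"
proof -
  define p where "p = prox \<mu> g (z + \<mu> *\<^sub>R y)"
  have "0 \<le> inner ((1 / \<mu>) *\<^sub>R (z + \<mu> *\<^sub>R y - p) - y) (p - z)"
    unfolding p_def by (rule subdifferential_monotone[OF proper prox_subdifferential assms])
  also have "(1 / \<mu>) *\<^sub>R (z + \<mu> *\<^sub>R y - p) - y = (- 1 / \<mu>) *\<^sub>R (p - z)"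
    using \<mu> by (simp add: algebra_simps)
  finally have "(norm (p - z))\<^sup>2 / \<mu> \<le> 0" by (simp add: power2_norm_eq_inner)
  then show ?thesis using \<mu> by (simp add: p_def divide_le_0_iff)
qed

text \<open>\<open>v - w\<close> splits into the difference of the residuals and the difference of
  the proximal points; by monotonicity of the subdifferential these two have nonnegative inner
  product.\<close>

lemma prox_residual_firmly_nonexpansive:
  "(norm ((v - prox \<mu> g v) - (w - prox \<mu> g w)))\<^sup>2
     \<le> inner ((v - prox \<mu> g v) - (w - prox \<mu> g w)) (v - w)"
proof -
  define p q where "p = prox \<mu> g v" and "q = prox \<mu> g w"
  have "0 \<le> inner ((1 / \<mu>) *\<^sub>R (v - p) - (1 / \<mu>) *\<^sub>R (w - q)) (p - q)"
    unfolding p_def q_def by (rule subdifferential_monotone[OF proper prox_subdifferential prox_subdifferential])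
  also have "\<dots> = 1 / \<mu> * inner ((v - p) - (w - q)) (p - q)" by (simp add: inner_diff algebra_simps)
  finally have "0 \<le> inner ((v - p) - (w - q)) (p - q)" using \<mu> by (simp add: zero_le_divide_iff)
  moreover have "v - w = ((v - p) - (w - q)) + (p - q)" by simp
  ultimately show ?thesis
    unfolding p_def[symmetric] q_def[symmetric] power2_norm_eq_inner
    by (metis (no_types) inner_add_right le_add_same_cancel1)
qed

section \<open>Smoothness of the Moreau envelope\<close>

lemma moreau_le:
  "moreau \<mu> g w \<le> moreau \<mu> g v + inner ((1 / \<mu>) *\<^sub>R (v - prox \<mu> g v)) (w - v)
     + 1 / (2 * \<mu>) * (norm (w - v))\<^sup>2"
proof -
  define p where "p = prox \<mu> g v"
  obtain a where a: "g p = ereal a" using prox_finite[of v] by (auto simp: p_def)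
  obtain b where b: "g (prox \<mu> g w) = ereal b" using prox_finite[of w] by auto
  \<comment> \<open>The proximal point of \<open>v\<close> serves as a competitor in the
    minimisation at \<open>w\<close>.\<close>
  have "moreau \<mu> g w \<le> a + 1 / (2 * \<mu>) * (norm (p - w))\<^sup>2"
    using prox_minimal[of w p] by (simp add: moreau_def a b)
  moreover have "moreau \<mu> g v = a + 1 / (2 * \<mu>) * (norm (p - v))\<^sup>2"
    by (simp add: moreau_def a flip: p_def)
  moreover have pw: "(norm (p - w))\<^sup>2 = (norm (p - v))\<^sup>2 + 2 * inner (v - p) (w - v) + (norm (w - v))\<^sup>2"
    unfolding power2_norm_eq_inner by (simp add: inner_diff inner_commute)
  have "1 / (2 * \<mu>) * (norm (p - w))\<^sup>2
      = 1 / (2 * \<mu>) * (norm (p - v))\<^sup>2 + 1 / \<mu> * inner (v - p) (w - v) + 1 / (2 * \<mu>) * (norm (w - v))\<^sup>2"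
    using \<mu> unfolding pw by (simp add: field_simps)
  ultimately show ?thesis
    unfolding p_def[symmetric] inner_scaleR_left by linarith
qed

text \<open>The lower bound is the upper bound with \<open>v\<close> and \<open>w\<close> exchanged;
  monotonicity of the residual then replaces the slope at \<open>w\<close> by the slope at
  \<open>v\<close>.\<close>

lemma moreau_quadratic_approx:
  "\<bar>moreau \<mu> g w - moreau \<mu> g v - inner ((1 / \<mu>) *\<^sub>R (v - prox \<mu> g v)) (w - v)\<bar>
     \<le> 1 / (2 * \<mu>) * (norm (w - v))\<^sup>2"
proof -
  define r s where "r = v - prox \<mu> g v" and "s = w - prox \<mu> g w"
  have "0 \<le> inner (s - r) (w - v)"
    using prox_residual_firmly_nonexpansive[of w v] unfolding r_def s_def
    by (meson order_trans zero_le_power2)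
  then have "1 / \<mu> * inner r (w - v) \<le> 1 / \<mu> * inner s (w - v)"
    using \<mu> by (intro mult_left_mono) (simp_all add: inner_diff_left)
  moreover have "inner s (v - w) = - inner s (w - v)" by (simp add: inner_diff_right)
  ultimately have "inner ((1 / \<mu>) *\<^sub>R r) (w - v) \<le> - inner ((1 / \<mu>) *\<^sub>R s) (v - w)"
    by simp
  then show ?thesis
    using moreau_le[of w v] moreau_le[of v w] unfolding r_def s_def
    by (simp add: norm_minus_commute)
qed

lemma GDERIV_moreau: "GDERIV (moreau \<mu> g) v :> (1 / \<mu>) *\<^sub>R (v - prox \<mu> g v)"
proof -
  define D where "D = (1 / \<mu>) *\<^sub>R (v - prox \<mu> g v)"
  have "((\<lambda>w. (1 / norm (w - v)) *\<^sub>R (moreau \<mu> g w - (moreau \<mu> g v + inner (w - v) D))) \<longlongrightarrow> 0) (at v)"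
  proof (rule Lim_null_comparison)
    show "\<forall>\<^sub>F w in at v. norm ((1 / norm (w - v)) *\<^sub>R (moreau \<mu> g w - (moreau \<mu> g v + inner (w - v) D)))
        \<le> 1 / (2 * \<mu>) * norm (w - v)"
    proof (rule eventually_mono[OF eventually_neq_at_within[of v]])
      fix w assume "w \<noteq> v"
      have "\<bar>moreau \<mu> g w - (moreau \<mu> g v + inner (w - v) D)\<bar> \<le> 1 / (2 * \<mu>) * (norm (w - v))\<^sup>2"
        using moreau_quadratic_approx[of w v] by (simp add: D_def inner_commute algebra_simps)
      then show "norm ((1 / norm (w - v)) *\<^sub>R (moreau \<mu> g w - (moreau \<mu> g v + inner (w - v) D)))
          \<le> 1 / (2 * \<mu>) * norm (w - v)"
        using \<open>w \<noteq> v\<close> by (simp add: pos_divide_le_eq power2_eq_square mult.assoc)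
    qed
    have "((\<lambda>w. 1 / (2 * \<mu>) * norm (w - v)) \<longlongrightarrow> 1 / (2 * \<mu>) * norm (v - v)) (at v)"
      by (intro tendsto_intros)
    then show "((\<lambda>w. 1 / (2 * \<mu>) * norm (w - v)) \<longlongrightarrow> 0) (at v)" by simp
  qed
  then show ?thesis
    unfolding gderiv_def has_derivative_at_within D_def[symmetric]
    by (auto simp: bounded_linear_inner_left divide_inverse diff_diff_eq)
qed

end

subsection \<open>Saddle-point dynamics\<close>

lemma strongly_monotone_converges_exponentially:
  fixes F P :: "'a::euclidean_space \<Rightarrow> 'a"
  assumes lip: "L-lipschitz_on UNIV F"
    and P: "linear P" "\<And>a b. inner (P a) b = inner a (P b)"
    and k: "0 < k" "\<And>a. k * (norm a)\<^sup>2 \<le> inner (P a) a"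
    and c: "0 < c" "\<And>a b. inner (P (F a - F b)) (a - b) \<le> - c * (norm (a - b))\<^sup>2"
  shows "(\<exists>!ws. F ws = 0) \<and>
    (\<exists>\<rho>>0. \<forall>ws. F ws = 0 \<longrightarrow> converges_exponentially \<rho> F ws)"
proof -
  obtain K where K: "0 < K" "\<And>a. norm (P a) \<le> K * norm a"
    using linear_bounded_pos[OF P(1)] by blast
  have "\<exists>!ws. F ws = 0"
  proof (rule ex_ex1I)
    show "\<exists>ws. F ws = 0"
      by (rule strongly_monotone_zero_exists[OF lip P k K(2,1) c])
    fix a b assume "F a = 0" "F b = 0"
    then have "c * (norm (a - b))\<^sup>2 \<le> 0" using c(2)[of a b] linear_0[OF P(1)] by simp
    then show "a = b" using c(1) by (simp add: mult_le_0_iff)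
  qed
  moreover have "converges_exponentially (c / K) F ws" if ws: "F ws = 0" for ws
    unfolding converges_exponentially_def
  proof (intro exI[of _ "sqrt (K / k)"] conjI allI impI)
    show "0 < sqrt (K / k)" using K k by simp
    show "\<exists>w. solves_ode F w0 w" for w0 by (rule solves_ode_exists_lipschitz[OF lip])
    show "norm (w t - ws) \<le> sqrt (K / k) * exp (- (c / K) * t) * norm (w 0 - ws)"
      if "solves_ode F w0 w" "0 \<le> t" for w0 w t
      by (rule strongly_monotone_decay[OF P k K(2,1) c ws that])
  qed
  ultimately show ?thesis using c(1) K(1) by (metis divide_pos_pos)
qed

text \<open>The Euclidean energy alone only gives \<open>- m * (norm x)\<^sup>2 - (norm e)\<^sup>2 / \<mu>\<close> with
  \<open>e = \<mu> *\<^sub>R (\<gamma> - y)\<close>, which does not control \<open>y\<close>. The cross term of the Lyapunov function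
  contributes \<open>- \<epsilon> * (norm (S y))\<^sup>2\<close> up to terms that the Euclidean part absorbs. Here \<open>a\<close> and \<open>\<gamma>\<close>
  stand for increments of the gradients of \<open>f\<close> and of the Moreau envelope.\<close>

lemma saddle_dissipation:
  fixes T :: "'a::real_inner \<Rightarrow> 'b::real_inner" and S :: "'b \<Rightarrow> 'a"
  assumes S: "linear S" and adj: "\<And>x y. inner (T x) y = inner x (S y)"
    and B: "\<And>x. norm (T x) \<le> B * norm x" "\<And>y. norm (S y) \<le> B * norm y"
    and \<mu>: "0 < \<mu>"
    and a: "m * (norm x)\<^sup>2 \<le> inner a x" "norm a \<le> L * norm x"
    and \<gamma>: "\<mu> * (norm \<gamma>)\<^sup>2 \<le> inner \<gamma> (T x + \<mu> *\<^sub>R y)"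
    and \<epsilon>: "0 \<le> \<epsilon>" "\<epsilon> * (L\<^sup>2 + B\<^sup>2) \<le> m / 2" "\<epsilon> * (1 + (B / \<mu>)\<^sup>2) \<le> 1 / \<mu>"
  shows "inner (- (a + S \<gamma>) + \<epsilon> *\<^sub>R S (\<mu> *\<^sub>R (\<gamma> - y))) x
       + inner (\<mu> *\<^sub>R (\<gamma> - y) + \<epsilon> *\<^sub>R T (- (a + S \<gamma>))) y
       \<le> - (m / 2) * (norm x)\<^sup>2 - \<epsilon> / 2 * (norm (S y))\<^sup>2"
proof -
  define e where "e = \<mu> *\<^sub>R (\<gamma> - y)"
  \<comment> \<open>Eliminating \<open>\<gamma>\<close> in favour of \<open>e\<close> exposes
    \<open>S y\<close> inside \<open>S \<gamma>\<close>; this is the source of the term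
    \<open>- (norm (S y))\<^sup>2\<close>.\<close>
  have \<gamma>e: "\<gamma> = y + (1 / \<mu>) *\<^sub>R e" using \<mu> by (simp add: e_def)
  define X s E where "X = norm x" and "s = norm (S y)" and "E = norm e"
  have nn: "0 \<le> X" "0 \<le> s" "0 \<le> E" by (auto simp: X_def s_def E_def)
  have euclid: "- inner (a + S \<gamma>) x + inner e y \<le> - m * X\<^sup>2 - E\<^sup>2 / \<mu>"
  proof -
    have "inner (S \<gamma>) x = inner \<gamma> (T x)" using adj[of x \<gamma>] by (simp add: inner_commute)
    moreover have "E\<^sup>2 / \<mu> = \<mu> * (norm \<gamma>)\<^sup>2 - 2 * \<mu> * inner \<gamma> y + \<mu> * inner y y"
    proof -
      have "E\<^sup>2 / \<mu> = \<mu> * (norm (\<gamma> - y))\<^sup>2"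
        using \<mu> by (simp add: E_def e_def power_mult_distrib power2_eq_square)
      then show ?thesis
        unfolding power2_norm_eq_inner by (simp add: inner_diff inner_commute algebra_simps)
    qed
    ultimately show ?thesis
      using \<gamma> a(1) by (simp add: e_def X_def inner_add inner_diff algebra_simps)
  qed
  \<comment> \<open>Young's inequality is weighted so that each of the two products containing
    \<open>s\<close> costs \<open>s\<^sup>2 / 4\<close>; half of the good term survives.\<close>
  have cross: "inner e (T x) - inner (a + S \<gamma>) (S y)
      \<le> (L\<^sup>2 + B\<^sup>2) * X\<^sup>2 + (1 + (B / \<mu>)\<^sup>2) * E\<^sup>2 - s\<^sup>2 / 2"
  proof -
    have "S \<gamma> = S y + (1 / \<mu>) *\<^sub>R S e"
      unfolding \<gamma>e by (simp add: linear_add[OF S] linear_cmul[OF S])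
    then have eq: "inner (a + S \<gamma>) (S y) = inner a (S y) + s\<^sup>2 + 1 / \<mu> * inner (S e) (S y)"
      by (simp add: s_def inner_add power2_norm_eq_inner)
    have "inner e (T x) \<le> E * (B * X)"
      using norm_cauchy_schwarz[of e "T x"] B(1)[of x] nn unfolding E_def X_def
      by (meson mult_left_mono norm_ge_zero order_trans)
    moreover have "- inner a (S y) \<le> L * X * s"
      using norm_cauchy_schwarz[of "- a" "S y"] a(2) nn unfolding s_def X_def
      by (simp add: mult_right_mono order_trans)
    moreover have "- (1 / \<mu> * inner (S e) (S y)) \<le> B / \<mu> * E * s"
    proof -
      have "- inner (S e) (S y) \<le> norm (S e) * norm (S y)"
        using norm_cauchy_schwarz[of "- S e" "S y"] by simp
      also have "\<dots> \<le> B * E * s" unfolding s_def E_def by (intro mult_right_mono B) simp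
      finally have "1 / \<mu> * (- inner (S e) (S y)) \<le> 1 / \<mu> * (B * E * s)"
        using \<mu> by (intro mult_left_mono) auto
      then show ?thesis by simp
    qed
    moreover have "E * (B * X) \<le> E\<^sup>2 + B\<^sup>2 * X\<^sup>2"
    proof -
      have "2 * (E * (B * X)) \<le> E\<^sup>2 + B\<^sup>2 * X\<^sup>2"
        using sum_squares_bound[of E "B * X"] by (simp add: power_mult_distrib mult.assoc)
      moreover have "0 \<le> E\<^sup>2 + B\<^sup>2 * X\<^sup>2" by simp
      ultimately show ?thesis by linarith
    qed
    moreover have "L * X * s \<le> L\<^sup>2 * X\<^sup>2 + s\<^sup>2 / 4"
      using zero_le_power2[of "L * X - s / 2"] by (simp add: power2_eq_square algebra_simps)
    moreover have "B / \<mu> * E * s \<le> (B / \<mu>)\<^sup>2 * E\<^sup>2 + s\<^sup>2 / 4"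
      using zero_le_power2[of "B / \<mu> * E - s / 2"] by (simp add: power2_eq_square algebra_simps)
    ultimately show ?thesis unfolding eq by (simp add: algebra_simps)
  qed
  have "inner (- (a + S \<gamma>) + \<epsilon> *\<^sub>R S e) x + inner (e + \<epsilon> *\<^sub>R T (- (a + S \<gamma>))) y
      = (- inner (a + S \<gamma>) x + inner e y) + \<epsilon> * (inner e (T x) - inner (a + S \<gamma>) (S y))"
  proof -
    have "inner (S e) x = inner e (T x)" by (metis adj inner_commute)
    then show ?thesis
      by (simp only: inner_add_left inner_scaleR_left adj inner_minus_left) (simp add: algebra_simps)
  qed
  also have "\<dots> \<le> (- m * X\<^sup>2 - E\<^sup>2 / \<mu>)
      + \<epsilon> * ((L\<^sup>2 + B\<^sup>2) * X\<^sup>2 + (1 + (B / \<mu>)\<^sup>2) * E\<^sup>2 - s\<^sup>2 / 2)"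
    by (intro add_mono euclid mult_left_mono cross \<epsilon>)
  also have "\<dots> = - m * X\<^sup>2 - E\<^sup>2 / \<mu> + (\<epsilon> * (L\<^sup>2 + B\<^sup>2)) * X\<^sup>2
      + (\<epsilon> * (1 + (B / \<mu>)\<^sup>2)) * E\<^sup>2 - \<epsilon> / 2 * s\<^sup>2"
    by (simp add: algebra_simps)
  also have "\<dots> \<le> - m * X\<^sup>2 - E\<^sup>2 / \<mu> + m / 2 * X\<^sup>2 + 1 / \<mu> * E\<^sup>2 - \<epsilon> / 2 * s\<^sup>2"
    by (intro add_mono diff_right_mono mult_right_mono \<epsilon> order_refl) auto
  finally show ?thesis unfolding e_def X_def s_def by simp
qed

lemma saddle_field_converges_exponentially:
  fixes T :: "'a::euclidean_space \<Rightarrow> 'b::euclidean_space" and S :: "'b \<Rightarrow> 'a"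
    and \<phi> :: "'a \<Rightarrow> 'a" and G :: "'b \<Rightarrow> 'b"
  assumes T: "linear T" and S: "linear S" and adj: "\<And>x y. inner (T x) y = inner x (S y)"
    and injS: "inj S"
    and \<mu>: "0 < \<mu>" and m: "0 < m"
    and \<phi>mono: "\<And>x x'. m * (norm (x - x'))\<^sup>2 \<le> inner (\<phi> x - \<phi> x') (x - x')"
    and \<phi>lip: "L-lipschitz_on UNIV \<phi>"
    and Gmono: "\<And>v v'. \<mu> * (norm (G v - G v'))\<^sup>2 \<le> inner (G v - G v') (v - v')"
  defines "F \<equiv> \<lambda>w. (- (\<phi> (fst w) + S (G (T (fst w) + \<mu> *\<^sub>R snd w))),
                     \<mu> *\<^sub>R (G (T (fst w) + \<mu> *\<^sub>R snd w) - snd w))"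
  shows "(\<exists>!ws. F ws = 0) \<and>
    (\<exists>\<rho>>0. \<forall>ws. F ws = 0 \<longrightarrow> converges_exponentially \<rho> F ws)"
proof -
  obtain B1 where B1: "0 < B1" "\<And>x. norm (T x) \<le> B1 * norm x"
    using linear_bounded_pos[OF T] by blast
  obtain B2 where B2: "0 < B2" "\<And>y. norm (S y) \<le> B2 * norm y"
    using linear_bounded_pos[OF S] by blast
  obtain \<sigma> where \<sigma>: "0 < \<sigma>" "\<And>y. \<sigma> * norm y \<le> norm (S y)"
    using linear_inj_bounded_below_pos[OF S injS] by blast
  define B where "B = max B1 B2"
  have B0: "0 < B" using B1(1) by (simp add: B_def)
  have B: "norm (T x) \<le> B * norm x" "norm (S y) \<le> B * norm y" for x y
  proof -
    show "norm (T x) \<le> B * norm x"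
      using B1(2)[of x] mult_right_mono[of B1 B "norm x"] by (simp add: B_def)
    show "norm (S y) \<le> B * norm y"
      using B2(2)[of y] mult_right_mono[of B2 B "norm y"] by (simp add: B_def)
  qed
  have L: "0 \<le> L" using \<phi>lip by (rule lipschitz_on_nonneg)
  \<comment> \<open>The first two bounds let the Euclidean dissipation absorb the cross terms; the
    third gives \<open>\<epsilon> * B \<le> 1 / 2\<close>, which keeps the Lyapunov form positive
    definite.\<close>
  define \<epsilon> where "\<epsilon> = min (m / 2 / (L\<^sup>2 + B\<^sup>2)) (min (1 / \<mu> / (1 + (B / \<mu>)\<^sup>2)) (1 / 2 / B))"
  have pos: "0 < L\<^sup>2 + B\<^sup>2" "0 < 1 + (B / \<mu>)\<^sup>2"
    using B0 by (auto intro: add_nonneg_pos add_pos_nonneg)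
  have \<epsilon>0: "0 < \<epsilon>" using pos B0 \<mu> m by (simp add: \<epsilon>_def)
  have "\<epsilon> \<le> m / 2 / (L\<^sup>2 + B\<^sup>2)" "\<epsilon> \<le> 1 / \<mu> / (1 + (B / \<mu>)\<^sup>2)" "\<epsilon> \<le> 1 / 2 / B"
    by (auto simp: \<epsilon>_def)
  then have \<epsilon>: "\<epsilon> * (L\<^sup>2 + B\<^sup>2) \<le> m / 2" "\<epsilon> * (1 + (B / \<mu>)\<^sup>2) \<le> 1 / \<mu>" "\<epsilon> * B \<le> 1 / 2"
    using pos B0 by (simp_all only: pos_le_divide_eq)
  define P where "P w = (fst w + \<epsilon> *\<^sub>R S (snd w), snd w + \<epsilon> *\<^sub>R T (fst w))" for w
  have linP: "linear P"
    by (rule linearI) (auto simp: P_def linear_add[OF T] linear_add[OF S] linear_cmul[OF T]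
        linear_cmul[OF S] algebra_simps)
  have symP: "inner (P a) b = inner a (P b)" for a b
    using adj[of "fst a" "snd b"] adj[of "fst b" "snd a"]
    by (simp add: P_def inner_prod_def inner_add inner_commute algebra_simps)
  have posP: "1 / 2 * (norm w)\<^sup>2 \<le> inner (P w) w" for w
  proof -
    obtain x y where w: "w = (x, y)" by (cases w)
    have "- inner (T x) y \<le> norm (T x) * norm y"
      using norm_cauchy_schwarz[of "- T x" y] by simp
    also have "\<dots> \<le> B * norm x * norm y" by (intro mult_right_mono B) simp
    finally have "\<epsilon> * (- inner (T x) y) \<le> \<epsilon> * (B * norm x * norm y)"
      using \<epsilon>0 by (intro mult_left_mono) auto
    also have "\<dots> = (\<epsilon> * B) * (norm x * norm y)" by simp
    also have "\<dots> \<le> 1 / 2 * (norm x * norm y)" by (intro mult_right_mono \<epsilon>) simp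
    finally have "- (2 * \<epsilon> * inner (T x) y) \<le> ((norm x)\<^sup>2 + (norm y)\<^sup>2) / 2"
      using sum_squares_bound[of "norm x" "norm y"] by simp
    moreover have "inner (P w) w = (norm x)\<^sup>2 + (norm y)\<^sup>2 + 2 * \<epsilon> * inner (T x) y"
      using adj[of x y]
      by (simp add: w P_def inner_prod_def inner_add inner_commute power2_norm_eq_inner)
    moreover have "(norm w)\<^sup>2 = (norm x)\<^sup>2 + (norm y)\<^sup>2" by (simp add: w norm_Pair)
    ultimately show ?thesis by simp
  qed
  \<comment> \<open>Injectivity of \<open>S\<close> enters here: \<open>\<sigma>\<close> turns
    control of \<open>S y\<close> into control of \<open>y\<close>.\<close>
  define c where "c = min (m / 2) (\<epsilon> / 2 * \<sigma>\<^sup>2)"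
  have c0: "0 < c" using m \<epsilon>0 \<sigma> by (simp add: c_def)
  have Fdiff: "F w - F w' =
      (- ((\<phi> (fst w) - \<phi> (fst w')) + S (G (T (fst w) + \<mu> *\<^sub>R snd w) - G (T (fst w') + \<mu> *\<^sub>R snd w'))),
       \<mu> *\<^sub>R ((G (T (fst w) + \<mu> *\<^sub>R snd w) - G (T (fst w') + \<mu> *\<^sub>R snd w')) - (snd w - snd w')))"
    for w w'
    by (simp add: F_def linear_diff[OF S] algebra_simps)
  have varg: "T (fst w) + \<mu> *\<^sub>R snd w - (T (fst w') + \<mu> *\<^sub>R snd w')
      = T (fst w - fst w') + \<mu> *\<^sub>R (snd w - snd w')" for w w'
    by (simp add: linear_diff[OF T] algebra_simps)
  have diss: "inner (P (F w - F w')) (w - w') \<le> - c * (norm (w - w'))\<^sup>2" for w w'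
  proof -
    define x y where "x = fst w - fst w'" and "y = snd w - snd w'"
    define a where "a = \<phi> (fst w) - \<phi> (fst w')"
    define \<gamma> where "\<gamma> = G (T (fst w) + \<mu> *\<^sub>R snd w) - G (T (fst w') + \<mu> *\<^sub>R snd w')"
    have "inner (P (F w - F w')) (w - w')
        = inner (- (a + S \<gamma>) + \<epsilon> *\<^sub>R S (\<mu> *\<^sub>R (\<gamma> - y))) x
          + inner (\<mu> *\<^sub>R (\<gamma> - y) + \<epsilon> *\<^sub>R T (- (a + S \<gamma>))) y"
      unfolding Fdiff a_def[symmetric] \<gamma>_def[symmetric] y_def[symmetric]
      by (simp add: P_def inner_prod_def x_def y_def)
    also have "\<dots> \<le> - (m / 2) * (norm x)\<^sup>2 - \<epsilon> / 2 * (norm (S y))\<^sup>2"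
    proof (rule saddle_dissipation[OF S adj B \<mu>])
      show "m * (norm x)\<^sup>2 \<le> inner a x" unfolding x_def a_def by (rule \<phi>mono)
      show "norm a \<le> L * norm x"
        unfolding x_def a_def by (rule lipschitz_on_normD[OF \<phi>lip]) auto
      show "\<mu> * (norm \<gamma>)\<^sup>2 \<le> inner \<gamma> (T x + \<mu> *\<^sub>R y)"
        unfolding x_def y_def \<gamma>_def varg[symmetric] by (rule Gmono)
    qed (use \<epsilon>0 \<epsilon> in auto)
    also have "\<dots> \<le> - c * (norm x)\<^sup>2 - c * (norm y)\<^sup>2"
    proof -
      have "c * (norm x)\<^sup>2 \<le> m / 2 * (norm x)\<^sup>2" by (intro mult_right_mono) (auto simp: c_def)
      moreover have "c * (norm y)\<^sup>2 \<le> \<epsilon> / 2 * \<sigma>\<^sup>2 * (norm y)\<^sup>2"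
        by (intro mult_right_mono) (auto simp: c_def)
      moreover have "\<epsilon> / 2 * (\<sigma> * norm y)\<^sup>2 \<le> \<epsilon> / 2 * (norm (S y))\<^sup>2"
        using \<epsilon>0 \<sigma> by (intro mult_left_mono power_mono) auto
      ultimately show ?thesis by (simp add: power_mult_distrib)
    qed
    also have "\<dots> = - c * (norm (w - w'))\<^sup>2"
      by (simp add: x_def y_def norm_prod_def algebra_simps)
    finally show ?thesis .
  qed
  \<comment> \<open>By Cauchy-Schwarz, cocoercivity makes \<open>G\<close> Lipschitz with constant
    \<open>1 / \<mu>\<close>. Its argument moves by at most \<open>(B + \<mu>) * norm d\<close>, and
    \<open>M\<close> is the quotient of \<open>B + \<mu>\<close> by \<open>\<mu>\<close>.\<close>
  define M where "M = B / \<mu> + 1"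
  have lipF: "(L + B * M + \<mu> * (M + 1))-lipschitz_on UNIV F"
  proof (rule lipschitz_onI)
    show "0 \<le> L + B * M + \<mu> * (M + 1)" using L B0 \<mu> by (simp add: M_def)
    fix w w' :: "'a \<times> 'b"
    define d where "d = w - w'"
    define \<gamma> where "\<gamma> = G (T (fst w) + \<mu> *\<^sub>R snd w) - G (T (fst w') + \<mu> *\<^sub>R snd w')"
    have xd: "norm (fst w - fst w') \<le> norm d" and yd: "norm (snd w - snd w') \<le> norm d"
      using norm_fst_le[of "fst d" "snd d"] norm_snd_le[of "snd d" "fst d"]
      unfolding prod.collapse by (simp_all add: d_def)
    have "\<mu> * (norm \<gamma>)\<^sup>2 \<le> inner \<gamma> (T (fst w - fst w') + \<mu> *\<^sub>R (snd w - snd w'))"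
      unfolding \<gamma>_def varg[symmetric] by (rule Gmono)
    also have "\<dots> \<le> norm \<gamma> * norm (T (fst w - fst w') + \<mu> *\<^sub>R (snd w - snd w'))"
      by (rule norm_cauchy_schwarz)
    also have "\<dots> \<le> norm \<gamma> * (B * norm d + \<mu> * norm d)"
    proof (intro mult_left_mono norm_ge_zero norm_triangle_mono)
      show "norm (T (fst w - fst w')) \<le> B * norm d"
        using B(1) xd B0 by (meson less_imp_le mult_left_mono order_trans)
      show "norm (\<mu> *\<^sub>R (snd w - snd w')) \<le> \<mu> * norm d" using yd \<mu> by simp
    qed
    also have "\<dots> = norm \<gamma> * (\<mu> * (M * norm d))" using \<mu> by (simp add: M_def field_simps)
    finally have "norm \<gamma> * (\<mu> * norm \<gamma>) \<le> norm \<gamma> * (\<mu> * (M * norm d))"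
      by (simp add: power2_eq_square ac_simps)
    moreover have "0 \<le> M * norm d" using B0 \<mu> by (simp add: M_def)
    ultimately have \<gamma>d: "norm \<gamma> \<le> M * norm d"
      using \<mu> by (cases "\<gamma> = 0") auto
    have "norm (F w - F w') \<le> norm ((\<phi> (fst w) - \<phi> (fst w')) + S \<gamma>) + norm (\<mu> *\<^sub>R (\<gamma> - (snd w - snd w')))"
      unfolding Fdiff \<gamma>_def[symmetric]
      by (rule order_trans[OF norm_Pair_le]) (simp add: norm_minus_cancel del: minus_add_distrib norm_scaleR)
    also have "\<dots> \<le> (L * norm d + B * (M * norm d)) + \<mu> * (M * norm d + norm d)"
    proof (intro add_mono norm_triangle_mono)
      show "norm (\<phi> (fst w) - \<phi> (fst w')) \<le> L * norm d"
        using lipschitz_on_normD[OF \<phi>lip, of "fst w" "fst w'"] xd L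
        by (meson UNIV_I mult_left_mono order_trans)
      show "norm (S \<gamma>) \<le> B * (M * norm d)"
        using B(2) \<gamma>d B0 by (meson less_imp_le mult_left_mono order_trans)
      have "norm (\<gamma> - (snd w - snd w')) \<le> M * norm d + norm d"
        using norm_triangle_ineq4[of \<gamma> "snd w - snd w'"] \<gamma>d yd by linarith
      then show "norm (\<mu> *\<^sub>R (\<gamma> - (snd w - snd w'))) \<le> \<mu> * (M * norm d + norm d)"
        using \<mu> by simp
    qed
    also have "\<dots> = (L + B * M + \<mu> * (M + 1)) * norm d" by (simp add: algebra_simps)
    finally show "dist (F w) (F w') \<le> (L + B * M + \<mu> * (M + 1)) * dist w w'"
      by (simp add: dist_norm d_def)
  qed
  show ?thesis
    by (rule strongly_monotone_converges_exponentially[OF lipF linP symP _ posP c0 diss]) simp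
qed

theorem theorem3:
  fixes f :: "real^'n \<Rightarrow> real"
    and g :: "real^'m \<Rightarrow> ereal"
    and T :: "real^'n^'m"
    and m\<^sub>f L\<^sub>f \<mu> :: real
  assumes "\<forall>x. f differentiable (at x)"
    and "m\<^sub>f > 0" and "strongly_convex m\<^sub>f f"
    and "L\<^sub>f-lipschitz_on UNIV (gradient f)"
    and "proper_fun g" and "lsc_fun g" and "convex_fun g"
    and "rank (T ** transpose T) = CARD('m)"
    and "\<mu> > 0"
    and feasible: "\<exists>x. ereal (f x) + g (T *v x) < \<infinity>"
    and finite_minimum: "\<bar>INF x. ereal (f x) + g (T *v x)\<bar> \<noteq> \<infinity>"
    and "\<mu> \<ge> L\<^sub>f - m\<^sub>f"
  shows "(\<forall>x y.
            GDERIV (\<lambda>x. prox_aug_lagrangian \<mu> f g T x y) x :>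
              (gradient f x + transpose T *v gradient (moreau \<mu> g) (T *v x + \<mu> *\<^sub>R y)) \<and>
            GDERIV (\<lambda>y. prox_aug_lagrangian \<mu> f g T x y) y :>
              (\<mu> *\<^sub>R (gradient (moreau \<mu> g) (T *v x + \<mu> *\<^sub>R y) - y))) \<and>
         (\<exists>!w. optimal_primal_dual f g T w) \<and>
         (\<exists>\<rho>>0. \<forall>w. optimal_primal_dual f g T w \<longrightarrow>
            converges_exponentially \<rho> (gradient_flow_field \<mu> f g T) w)"
proof -
  note \<mu> = \<open>\<mu> > 0\<close>
  note g = \<open>proper_fun g\<close> \<open>lsc_fun g\<close> \<open>convex_fun g\<close> \<mu>
  have diff: "f differentiable (at x)" for x using assms(1) by blast
  define G where "G v = (1 / \<mu>) *\<^sub>R (v - prox \<mu> g v)" for v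
  have dM: "GDERIV (moreau \<mu> g) v :> G v" for v
    unfolding G_def by (rule GDERIV_moreau[OF g])
  have gradM: "gradient (moreau \<mu> g) v = G v" for v by (rule gradient_eqI[OF dM])
  have adj: "inner (T *v x) y = inner x (transpose T *v y)" for x y
    by (metis dot_lmul_matrix inner_commute transpose_matrix_vector)
  have Dx: "GDERIV (\<lambda>x. prox_aug_lagrangian \<mu> f g T x y) x :>
      (gradient f x + transpose T *v G (T *v x + \<mu> *\<^sub>R y))" for x y
  proof -
    have "((\<lambda>x. T *v x + \<mu> *\<^sub>R y) has_derivative (*v) T) (at x)"
      by (auto intro!: derivative_eq_intros bounded_linear_imp_has_derivative)
    from has_derivative_compose[OF this dM[unfolded gderiv_def]]
    have "GDERIV (\<lambda>x. moreau \<mu> g (T *v x + \<mu> *\<^sub>R y)) x :> transpose T *v G (T *v x + \<mu> *\<^sub>R y)"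
      by (simp add: gderiv_def adj)
    then have "GDERIV (\<lambda>x. f x + moreau \<mu> g (T *v x + \<mu> *\<^sub>R y) - \<mu> / 2 * (norm y)\<^sup>2) x :>
        (gradient f x + transpose T *v G (T *v x + \<mu> *\<^sub>R y) - 0)"
      by (intro GDERIV_diff GDERIV_add GDERIV_gradient diff GDERIV_const)
    then show ?thesis by (simp add: prox_aug_lagrangian_def)
  qed
  have Dy: "GDERIV (\<lambda>y. prox_aug_lagrangian \<mu> f g T x y) y :>
      (\<mu> *\<^sub>R (G (T *v x + \<mu> *\<^sub>R y) - y))" for x y
  proof -
    have "((\<lambda>y. T *v x + \<mu> *\<^sub>R y) has_derivative (\<lambda>h. \<mu> *\<^sub>R h)) (at y)"
      by (auto intro!: derivative_eq_intros)
    from has_derivative_compose[OF this dM[unfolded gderiv_def]]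
    have "GDERIV (\<lambda>y. moreau \<mu> g (T *v x + \<mu> *\<^sub>R y)) y :> \<mu> *\<^sub>R G (T *v x + \<mu> *\<^sub>R y)"
      by (simp add: gderiv_def)
    moreover have "GDERIV (\<lambda>y. \<mu> / 2 * (norm y)\<^sup>2) y :> \<mu> *\<^sub>R y"
      unfolding gderiv_def power2_norm_eq_inner
      by (auto intro!: derivative_eq_intros simp: inner_commute)
    ultimately have "GDERIV (\<lambda>y. f x + moreau \<mu> g (T *v x + \<mu> *\<^sub>R y) - \<mu> / 2 * (norm y)\<^sup>2) y :>
        (0 + \<mu> *\<^sub>R G (T *v x + \<mu> *\<^sub>R y) - \<mu> *\<^sub>R y)"
      by (intro GDERIV_diff GDERIV_add GDERIV_const)
    then show ?thesis by (simp add: prox_aug_lagrangian_def algebra_simps)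
  qed
  define F where "F = (\<lambda>w. (- (gradient f (fst w) + transpose T *v G (T *v fst w + \<mu> *\<^sub>R snd w)),
      \<mu> *\<^sub>R (G (T *v fst w + \<mu> *\<^sub>R snd w) - snd w)))"
  have field: "gradient_flow_field \<mu> f g T = F"
    unfolding F_def gradient_flow_field_def
    by (intro ext) (simp only: gradient_eqI[OF Dx] gradient_eqI[OF Dy])
  have opt: "optimal_primal_dual f g T w \<longleftrightarrow> F w = 0" for w
  proof -
    obtain x y where w: "w = (x, y)" by (cases w)
    \<comment> \<open>The \<open>y\<close> equation at rest says that the proximal point of
      \<open>T *v x + \<mu> *\<^sub>R y\<close> is \<open>T *v x\<close>, which is the subgradient
      inclusion in resolvent form.\<close>
    have "y \<in> subdifferential g (T *v x) \<longleftrightarrow> G (T *v x + \<mu> *\<^sub>R y) = y"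
    proof
      assume "y \<in> subdifferential g (T *v x)"
      then show "G (T *v x + \<mu> *\<^sub>R y) = y" using \<mu> by (simp add: G_def prox_eqI[OF g])
    next
      define v where "v = T *v x + \<mu> *\<^sub>R y"
      assume "G (T *v x + \<mu> *\<^sub>R y) = y"
      then have y: "G v = y" by (simp add: v_def)
      then have "\<mu> *\<^sub>R y = v - prox \<mu> g v" using \<mu> by (auto simp: G_def)
      then have "prox \<mu> g v = T *v x" by (simp add: v_def algebra_simps)
      then show "y \<in> subdifferential g (T *v x)"
        using prox_subdifferential[OF g, of v] y by (simp add: G_def)
    qed
    then show ?thesis
      using \<mu> by (auto simp: optimal_primal_dual_def F_def w zero_prod_def neg_eq_iff_add_eq_0)
  qed
  have "(\<exists>!w. F w = 0) \<and> (\<exists>\<rho>>0. \<forall>w. F w = 0 \<longrightarrow> converges_exponentially \<rho> F w)"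
    unfolding F_def
  proof (rule saddle_field_converges_exponentially[OF _ _ adj _ \<mu> \<open>m\<^sub>f > 0\<close>])
    show "linear ((*v) T)" "linear ((*v) (transpose T))"
      by (rule matrix_vector_mul_linear)+
    \<comment> \<open>Full rank makes the product injective, and the factor applied first inherits
      injectivity.\<close>
    show "inj ((*v) (transpose T))"
    proof -
      have "inj ((*v) (T ** transpose T))" using assms(8) full_rank_injective by blast
      then have "inj ((*v) T \<circ> (*v) (transpose T))"
        by (simp only: o_def matrix_vector_mul_assoc)
      then show ?thesis by (rule inj_on_imageI2)
    qed
    show "m\<^sub>f * (norm (x - x'))\<^sup>2 \<le> inner (gradient f x - gradient f x') (x - x')" for x x'
      by (rule strongly_convex_gradient_monotone[OF diff \<open>strongly_convex m\<^sub>f f\<close>])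
    \<comment> \<open>Firm nonexpansiveness of the residual, rescaled: dividing the residual by
      \<open>\<mu>\<close> turns the constant \<open>1\<close> into \<open>\<mu>\<close>.\<close>
    show "\<mu> * (norm (G v - G v'))\<^sup>2 \<le> inner (G v - G v') (v - v')" for v v'
    proof -
      define r where "r = (v - prox \<mu> g v) - (v' - prox \<mu> g v')"
      have Gr: "G v - G v' = (1 / \<mu>) *\<^sub>R r" by (simp add: G_def r_def scaleR_diff_right)
      have "(norm r)\<^sup>2 \<le> inner r (v - v')"
        unfolding r_def by (rule prox_residual_firmly_nonexpansive[OF g])
      then show ?thesis using \<mu> unfolding Gr
        by (simp add: power_mult_distrib power2_eq_square divide_right_mono)
    qed
  qed (use assms(4) in auto)
  then show ?thesis using Dx Dy unfolding gradM field opt by blast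
qed

end
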